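(* Under the standing assumptions in the context, let the step size sequence $\{\alpha(t)\}_{t\ge0}$ be nonnegative and nonincreasing with $\alpha(0)>0$. Let $\{\mathbf{x}_i(t)\}$ be generated by Algorithm 1 or by Algorithm 2. Put $\bar{\mathbf{x}}(t)=\sum_{j\in\mathcal{V}}\pi_j\mathbf{x}_j(t)$, $\mathbf{s}(t)=P_X(\bar{\mathbf{x}}(t))$ and $$\tilde{\mathbf{x}}_i(t)=\frac{\sum_{k=0}^t\alpha(k)\mathbf{x}_i(k)}{\sum_{k=0}^t\alpha(k)},\qquad \tilde{\mathbf{s}}(t)=\frac{\sum_{k=0}^t\alpha(k)\mathbf{s}(k)}{\sum_{k=0}^t\alpha(k)}.$$ Let $\mathbf{x}^*\in X^*$ be arbitrary and define, with the constants of the context, $$R_2=\tfrac12\prod_{k=0}^\infty(1+D_1\lambda^{2k}),\qquad R_1=R_2\sum_{i\in\mathcal{V}}\pi_i\|\mathbf{x}_i(0)-\mathbf{x}^*\|^2,\qquad C_0=\frac{D_6(1-\lambda)}{2n(Rn+1)C},$$ $$C_1=R_1+\frac{R_2D_{24}\alpha(0)}{1-\lambda}+\frac{D_6D_4\alpha(0)}{2nC},\qquad C_2=R_2\Big(\frac{D_{21}}{1-\lambda}+D_3'\Big)+\frac{D_6}{2n}\Big(\frac{D_1}{C}+\frac14\Big),$$ $$E(t)=\frac{C_1+C_2\sum_{k=0}^t\alpha^2(k)}{\sum_{k=0}^t\alpha(k)}.$$ Then for all $i\in\mathcal{V}$ and all $t\ge0$, $$C_0\|\tilde{\mathbf{x}}_i(t)-\tilde{\mathbf{s}}(t)\|+F(\tilde{\mathbf{s}}(t))-F^*\le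 E(t),$$ and moreover $$|F(\tilde{\mathbf{x}}_i(t))-F^*|\le E(t)\Big(1+\frac{nL}{C_0}\Big).$$
   Context: Network. $\mathcal{V}=\{1,\dots,n\}$ is the set of agents; $\mathcal{G}=(\mathcal{V},\mathcal{E})$ is a fixed, strongly connected directed graph. Agents have unique identifiers and know $n$ (or an upper bound on it). The weight matrix $W=[w_{ij}]\in\mathbb{R}^{n\times n}$ is nonnegative and row stochastic ($W\mathbf{1}=\mathbf{1}$), with $w_{ii}>0$ for all $i$, $w_{ij}>0$ for $(i,j)\in\mathcal{E}$, and $w_{ij}=0$ otherwise. $\boldsymbol{\pi}>\mathbf{0}$ is the normalized left Perron eigenvector: $\boldsymbol{\pi}^{\mathsf T}W=\boldsymbol{\pi}^{\mathsf T}$, $\mathbf{1}^{\mathsf T}\boldsymbol{\pi}=1$; $\pi_{\min}=\min_i\pi_i$. $|\lambda_2(W)|<1$ is the second largest modulus of the eigenvalues of $W$. Problem. For each $i\in\mathcal{V}$, $f_i:\mathbb{R}^m\to\mathbb{R}$ is convex and $X_i\subseteq\mathbb{R}^m$ is closed and convex; $X=\bigcap_{i}X_i\ne\varnothing$; $F=\sum_i f_i$; $F^*=\min_X F$ and $X^*$ is the set of minimizers of $F$ over $X$, assumed nonempty. Let $U=\mathrm{conv}(\bigcup_i X_i)$ be the convex hull. $\mathrm{dist}$ is Euclidean distance, $\|\cdot\|$ the Euclidean norm, $P_Y$ the Euclidean projection onto a nonempty closed convex set $Y$, $\partial f$ the convex subdifferential. - Regularity: $R\ge1$ is a regularity constant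 of $\{X_i\}$ with respect to $U$: $\mathrm{dist}(\mathbf{x},X)\le R\max_{i\in\mathcal{V}}\mathrm{dist}(\mathbf{x},X_i)$ for all $\mathbf{x}\in U$ (such an $R$ is assumed to exist). - Bounded subgradients: $L\in(0,\infty)$ is such that $\|\mathbf{g}\|\le L$ for all $\mathbf{g}\in\partial f_i(\mathbf{x})$, all $\mathbf{x}\in U$, all $i\in\mathcal{V}$. Algorithm 1. Each agent $i$ initializes $\mathbf{x}_i(0)$ and sets $\mathbf{z}_i(0)=\mathbf{e}_i\in\mathbb{R}^n$ ($i$-th standard basis vector). For $t\ge0$, $$\mathbf{x}_i(t+1)=P_{X_i}\Big(\sum_{j}w_{ij}\mathbf{x}_j(t)-\alpha(t)\frac{\mathbf{g}_i(t)}{z_{ii}(t)}\Big),\qquad \mathbf{z}_i(t+1)=\sum_j w_{ij}\mathbf{z}_j(t),$$ where $\mathbf{g}_i(t)\in\partial f_i\big(\sum_j w_{ij}\mathbf{x}_j(t)\big)$ and $z_{ii}(t)$ is the $i$-th entry of $\mathbf{z}_i(t)$. Algorithm 2. Same initialization and same $\mathbf{z}$-update, but $$\mathbf{x}_i(t+1)=P_{X_i}\Big(\sum_{j}w_{ij}\big(\mathbf{x}_j(t)-\alpha(t)\tfrac{\mathbf{g}_j(t)}{z_{jj}(t)}\big)\Big),\qquad \mathbf{g}_i(t)\in\partial f_i(\mathbf{x}_i(t)).$$ Constants. Fix $\lambda\in(|\lambda_2(W)|,1)$, and $C>0$, $\eta>0$ such that $|[W^t]_{ji}-\pi_i|\le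 C\lambda^t$, $|z_{ii}(t)-\pi_i|\le C\lambda^t$ and $\eta^{-1}\le z_{ii}(t)\le1$ for all $i,j\in\mathcal{V}$, $t\ge0$ (such constants exist). Set $D_1=nCL\eta$, $D_2=2L\eta$, $D_3=L^2\eta^2+nLC\eta$, $D_4=C\sum_{j}\|\mathbf{x}_j(0)\|$, $D_2'=D_2+\frac{2LR}{\pi_{\min}}$, $b=\sqrt{\pi_{\min}/n}$, $a=\frac{D_2'C}{(1-\lambda)b}$, $D_6=\frac{\pi_{\min}}{2}$, $D_{24}=D_2'D_4$, $D_{21}=D_2'D_1$, $D_3'=D_3+\frac{a^2}{2}$.
   Formalization: The formal theorem additionally assumes that every agent starts in its own constraint set, x_i(0) ∈ X_i; for arbitrary starting points the stated bounds can fail, since subgradients are bounded only on U. *)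

theory Defs
  imports "HOL-Analysis.Analysis" "HOL-Computational_Algebra.Polynomial"
begin

primrec matpow :: "real^'n^'n \<Rightarrow> nat \<Rightarrow> real^'n^'n" where
  "matpow A 0 = mat 1"
| "matpow A (Suc t) = matpow A t ** A"

definition charpoly :: "'a::comm_ring_1^'n^'n \<Rightarrow> 'a poly" where
  "charpoly A = det (\<chi> i j. (if i = j then [:0, 1:] else 0) - [:A $ i $ j:])"

text \<open>The moduli of the complex eigenvalues of a real matrix, in decreasing order and
  repeated according to algebraic multiplicity.\<close>

definition eigenvalue_moduli :: "real^'n^'n \<Rightarrow> real list" where
  "eigenvalue_moduli A =
     rev (sorted_list_of_multiset
       (image_mset cmod (proots (charpoly (\<chi> i j. complex_of_real (A $ i $ j))))))"

text \<open>A \<open>1 \<times> 1\<close> matrix has no second eigenvalue; the value 0 is used by convention.\<close>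

definition second_eigenvalue_modulus :: "real^'n^'n \<Rightarrow> real" where
  "second_eigenvalue_modulus A = (if CARD('n) = 1 then 0 else eigenvalue_moduli A ! 1)"

definition subdifferential :: "('a::real_inner \<Rightarrow> real) \<Rightarrow> 'a \<Rightarrow> 'a set" where
  "subdifferential f x = {g. \<forall>y. f y \<ge> f x + g \<bullet> (y - x)}"

text \<open>\<open>zseq W t i\<close> is the vector held by agent \<open>i\<close> at time \<open>t\<close>; its entry
  \<open>zseq W t i $ i\<close> is agent \<open>i\<close>'s current estimate of the \<open>i\<close>-th entry of the
  left Perron vector of \<open>W\<close>.\<close>

primrec zseq :: "real^'n^'n \<Rightarrow> nat \<Rightarrow> 'n \<Rightarrow> real^'n" where
  "zseq W 0 i = axis i 1"
| "zseq W (Suc t) i = (\<Sum>j\<in>UNIV. W $ i $ j *\<^sub>R zseq W t j)"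

text \<open>In both algorithms \<open>x t i\<close> is the iterate of agent \<open>i\<close> at time \<open>t\<close> and \<open>g t i\<close> is
  the subgradient it selects. The subgradient selection is arbitrary, so the algorithms are
  relations between sequences rather than functions. The first one evaluates subgradients
  at the averaged point, the second one at the agent's own iterate. Neither relation
  constrains the initial points \<open>x 0 i\<close>.\<close>

definition algorithm1 ::
  "real^'n^'n \<Rightarrow> ('n \<Rightarrow> (real^'m) set) \<Rightarrow> ('n \<Rightarrow> real^'m \<Rightarrow> real) \<Rightarrow> (nat \<Rightarrow> real)
    \<Rightarrow> (nat \<Rightarrow> 'n \<Rightarrow> real^'m) \<Rightarrow> (nat \<Rightarrow> 'n \<Rightarrow> real^'m) \<Rightarrow> bool" where
  "algorithm1 W X f \<alpha> g x \<longleftrightarrow>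
     (\<forall>t i. g t i \<in> subdifferential (f i) (\<Sum>j\<in>UNIV. W $ i $ j *\<^sub>R x t j) \<and>
        x (Suc t) i = closest_point (X i)
          ((\<Sum>j\<in>UNIV. W $ i $ j *\<^sub>R x t j) - (\<alpha> t / zseq W t i $ i) *\<^sub>R g t i))"

definition algorithm2 ::
  "real^'n^'n \<Rightarrow> ('n \<Rightarrow> (real^'m) set) \<Rightarrow> ('n \<Rightarrow> real^'m \<Rightarrow> real) \<Rightarrow> (nat \<Rightarrow> real)
    \<Rightarrow> (nat \<Rightarrow> 'n \<Rightarrow> real^'m) \<Rightarrow> (nat \<Rightarrow> 'n \<Rightarrow> real^'m) \<Rightarrow> bool" where
  "algorithm2 W X f \<alpha> g x \<longleftrightarrow>
     (\<forall>t i. g t i \<in> subdifferential (f i) (x t i) \<and>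
        x (Suc t) i = closest_point (X i)
          (\<Sum>j\<in>UNIV. W $ i $ j *\<^sub>R (x t j - (\<alpha> t / zseq W t j $ j) *\<^sub>R g t j)))"

end

theory Submission
  imports Defs
begin

text \<open>Track \<open>V t = (\<Sum>i. \<pi>\<^sub>i * |x\<^sub>i - x\<^sup>*|\<^sup>2)\<close>. One step of either algorithm decreases it by
  \<open>2 * \<alpha> t * (F (s t) - F x\<^sup>*)\<close> and by the weighted squared projection residuals \<open>\<phi>\<^sub>i\<close>, up to a
  factor \<open>1 + D1 * lam ^ (2 * t)\<close> (from the error of the Perron weight estimates \<open>z\<^sub>i\<^sub>i\<close>), terms of
  order \<open>(\<alpha> t)\<^sup>2\<close>, and a consensus error \<open>\<alpha> t * \<Delta> t\<close>. Viewing the iteration as averaging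
  perturbed by the residuals, \<open>\<Delta> t\<close> is a discounted sum of past step sizes and past residuals.
  Dividing by the partial products of the factors and summing, Young's inequality absorbs the
  residuals contained in \<open>\<Delta>\<close> into half of the residual decrease. The other half pays for the
  residuals in the bound of \<open>\<alpha> k * |x\<^sub>i k - s k|\<close>, and Jensen's inequality passes to the averages.\<close>

subsection \<open>Convex functions and projections\<close>

text \<open>A hyperplane separating the point \<open>(x, f x)\<close> from the strict epigraph
  cannot be vertical, because \<open>f\<close> is finite everywhere; its rescaled slope is a
  subgradient.\<close>

lemma subdifferential_nonempty:
  fixes f :: "'a::euclidean_space \<Rightarrow> real"
  assumes "convex_on UNIV f"
  shows "subdifferential f x \<noteq> {}"
proof -
  define S where "S = {(y, r). f y < r}"
  have "convex S"
    unfolding convex_def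
  proof (clarsimp simp: S_def)
    fix y z :: 'a and r q u v :: real
    assume *: "f y < r" "f z < q" "0 \<le> u" "0 \<le> v" "u + v = 1"
    have "f (u *\<^sub>R y + v *\<^sub>R z) \<le> u * f y + v * f z"
      using assms * by (simp add: convex_on_def)
    also have "\<dots> < u * r + v * q"
    proof (cases "u = 0")
      case False
      then have "u * f y < u * r" "v * f z \<le> v * q" using * by (simp_all add: mult_left_mono)
      then show ?thesis by linarith
    qed (use * in simp)
    finally show "f (u *\<^sub>R y + v *\<^sub>R z) < u * r + v * q" .
  qed
  moreover have "(x, f x + 1) \<in> S" "(x, f x) \<notin> S" by (auto simp: S_def)
  ultimately obtain a b where a: "a \<noteq> 0" "a \<bullet> (x, f x) \<le> b" "\<And>w. w \<in> S \<Longrightarrow> b \<le> a \<bullet> w"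
    using separating_hyperplane_sets[of "{(x, f x)}" S] by force
  obtain p q where pq: "a = (p, q)" by (cases a)
  have sep: "p \<bullet> x + q * f x \<le> p \<bullet> y + q * r" if "f y < r" for y r
    using a(2) a(3)[of "(y, r)"] that by (auto simp: S_def pq)
  have "q \<ge> 0" using sep[of x "f x + 1"] by (simp add: algebra_simps)
  moreover have "q \<noteq> 0"
  proof
    assume q: "q = 0"
    have "p \<bullet> p \<le> 0" using sep[of "x - p" "f (x - p) + 1"] by (simp add: q inner_diff_right)
    then have "p = 0" using inner_ge_zero[of p] inner_eq_zero_iff[of p] by linarith
    then show False using a(1) q pq by (simp add: zero_prod_def)
  qed
  ultimately have q: "q > 0" by simp
  have supp: "p \<bullet> x + q * f x \<le> p \<bullet> y + q * f y" for y
  proof (rule field_le_epsilon)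
    fix e :: real assume "e > 0"
    then show "p \<bullet> x + q * f x \<le> p \<bullet> y + q * f y + e"
      using sep[of y "f y + e / q"] q by (simp add: distrib_left)
  qed
  have "f x + ((- (1 / q)) *\<^sub>R p) \<bullet> (y - x) \<le> f y" for y
  proof -
    have "q * (f x + ((- (1 / q)) *\<^sub>R p) \<bullet> (y - x)) \<le> q * f y"
      using supp[of y] q by (simp add: ring_distribs inner_diff_right)
    then show ?thesis using q by simp
  qed
  then have "(- (1 / q)) *\<^sub>R p \<in> subdifferential f x" by (simp add: subdifferential_def)
  then show ?thesis by blast
qed

text \<open>The subgradient inequality at either of the two points bounds the difference of values
  in one direction. Existence of a subgradient there turns \<open>L\<close> into a Lipschitz
  constant on \<open>U\<close>.\<close>

lemma bounded_subgradients_Lipschitz: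
  fixes f :: "'a::euclidean_space \<Rightarrow> real"
  assumes "convex_on UNIV f"
    and bd: "\<And>y h. y \<in> U \<Longrightarrow> h \<in> subdifferential f y \<Longrightarrow> norm h \<le> L"
    and "y \<in> U" "z \<in> U"
  shows "\<bar>f y - f z\<bar> \<le> L * norm (y - z)"
proof -
  have *: "f a - f b \<le> L * norm (a - b)" if ab: "a \<in> U" for a b
  proof -
    obtain h where h: "h \<in> subdifferential f a" using subdifferential_nonempty[OF assms(1)] by blast
    have "f a - f b \<le> h \<bullet> (a - b)"
      using h by (simp add: subdifferential_def inner_diff_right) (smt (verit))
    also have "\<dots> \<le> norm h * norm (a - b)" by (rule norm_cauchy_schwarz)
    also have "\<dots> \<le> L * norm (a - b)" using bd[OF ab h] by (simp add: mult_right_mono)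
    finally show ?thesis .
  qed
  show ?thesis using *[of y z] *[of z y] assms by (simp add: norm_minus_commute abs_le_iff)
qed

text \<open>The angle at the projection towards any point of \<open>S\<close> is not acute. The
  subtracted square is the source of the residual decrease in the Lyapunov recursion.\<close>

lemma closest_point_Pythagoras:
  fixes S :: "'a::euclidean_space set"
  assumes "closed S" "convex S" "z \<in> S"
  shows "(norm (closest_point S y - z))\<^sup>2 \<le> (norm (y - z))\<^sup>2 - (norm (closest_point S y - y))\<^sup>2"
proof -
  let ?c = "closest_point S y"
  have "(y - ?c) \<bullet> (z - ?c) \<le> 0" using assms by (intro closest_point_dot)
  moreover have "(norm (y - z))\<^sup>2 = (norm (?c - z))\<^sup>2 + (norm (?c - y))\<^sup>2 - 2 * ((y - ?c) \<bullet> (z - ?c))"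
    by (simp add: power2_norm_eq_inner algebra_simps inner_commute)
  ultimately show ?thesis by linarith
qed

lemma dist_closest_point_eq_infdist:
  fixes S :: "'a::euclidean_space set"
  assumes "closed S" "S \<noteq> {}"
  shows "dist y (closest_point S y) = infdist y S"
proof (rule antisym)
  show "dist y (closest_point S y) \<le> infdist y S"
    unfolding infdist_notempty[OF assms(2)]
    using assms by (intro cINF_greatest closest_point_le) auto
  show "infdist y S \<le> dist y (closest_point S y)"
    using assms by (intro infdist_le closest_point_in_set) auto
qed

text \<open>The difference of the two sides is the weighted variance of \<open>u\<close> around its
  mean.\<close>

lemma norm_sq_convex_combination:
  fixes u :: "'i::finite \<Rightarrow> 'a::real_inner"
  assumes "\<And>i. w i \<ge> 0" "(\<Sum>i\<in>UNIV. w i) = 1"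
  shows "(norm (\<Sum>i\<in>UNIV. w i *\<^sub>R u i))\<^sup>2 \<le> (\<Sum>i\<in>UNIV. w i * (norm (u i))\<^sup>2)"
proof -
  define m where "m = (\<Sum>i\<in>UNIV. w i *\<^sub>R u i)"
  have "0 \<le> (\<Sum>i\<in>UNIV. w i * (norm (u i - m))\<^sup>2)" using assms by (intro sum_nonneg) auto
  also have "\<dots> = (\<Sum>i\<in>UNIV. w i * (norm (u i))\<^sup>2 - 2 * ((w i *\<^sub>R u i) \<bullet> m) + w i * (norm m)\<^sup>2)"
    by (intro sum.cong) (auto simp: power2_norm_eq_inner algebra_simps inner_commute)
  also have "\<dots> = (\<Sum>i\<in>UNIV. w i * (norm (u i))\<^sup>2) - 2 * (m \<bullet> m) + (norm m)\<^sup>2"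
    by (simp only: sum.distrib sum_subtractf assms(2) m_def mult_1_left
        flip: sum_distrib_left sum_distrib_right inner_sum_left)
  finally show ?thesis by (simp add: power2_norm_eq_inner m_def)
qed

subsection \<open>Discounted sums and the Lyapunov recursion\<close>

lemma sum_geometric_le:
  fixes l :: real
  assumes "0 \<le> l" "l < 1"
  shows "(\<Sum>k<N. l ^ k) \<le> 1 / (1 - l)"
  using assms by (simp add: sum_gp_strict divide_right_mono)

text \<open>The exponent counts averaging steps: a perturbation made at time \<open>k\<close> first
  appears at time \<open>k + 1\<close> and is averaged \<open>t - 1 - k\<close> more times by time
  \<open>t\<close>, so the latest one is undamped.\<close>

definition discounted_sum :: "real \<Rightarrow> (nat \<Rightarrow> real) \<Rightarrow> nat \<Rightarrow> real" where
  "discounted_sum l c t = (\<Sum>k<t. l ^ (t - 1 - k) * c k)"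

lemma discounted_sum_0 [simp]: "discounted_sum l c 0 = 0"
  by (simp add: discounted_sum_def)

lemma discounted_sum_Suc: "discounted_sum l c (Suc t) = l * discounted_sum l c t + c t"
proof -
  have "(\<Sum>k<t. l ^ (t - k) * c k) = (\<Sum>k<t. l * (l ^ (t - 1 - k) * c k))"
    by (intro sum.cong) (auto simp: Suc_diff_Suc simp flip: power_Suc mult.assoc)
  then show ?thesis by (simp add: discounted_sum_def sum_distrib_left)
qed

lemma discounted_sum_nonneg: "0 \<le> l \<Longrightarrow> (\<And>k. 0 \<le> c k) \<Longrightarrow> 0 \<le> discounted_sum l c t"
  by (simp add: discounted_sum_def sum_nonneg)

lemma discounted_sum_mono:
  assumes "0 \<le> l" "\<And>k. c k \<le> d k"
  shows "discounted_sum l c t \<le> discounted_sum l d t"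
  unfolding discounted_sum_def using assms by (intro sum_mono mult_left_mono) auto

lemma discounted_sum_linear:
  "discounted_sum l (\<lambda>k. a * c k + b * d k) t = a * discounted_sum l c t + b * discounted_sum l d t"
  unfolding discounted_sum_def sum_distrib_left sum.distrib[symmetric]
  by (intro sum.cong) (auto simp: algebra_simps)

lemma discounted_sum_const_le:
  assumes "0 \<le> l" "l < 1" "0 \<le> d"
  shows "discounted_sum l (\<lambda>_. d) t \<le> d / (1 - l)"
proof -
  have "discounted_sum l (\<lambda>_. d) t = d * (\<Sum>k<t. l ^ k)"
    using sum.nat_diff_reindex[of "\<lambda>k. l ^ k" t]
    by (simp add: discounted_sum_def mult.commute flip: sum_distrib_left)
  then show ?thesis using mult_left_mono[OF sum_geometric_le[of l t] assms(3)] assms by simp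
qed

text \<open>When the recursion \<open>discounted_sum_Suc\<close> is summed, the two sides differ
  exactly by the last discounted sum.\<close>

lemma sum_discounted_sum_le:
  assumes "0 \<le> l" "l < 1" "\<And>k. 0 \<le> c k"
  shows "(1 - l) * (\<Sum>t<N. discounted_sum l c t) \<le> (\<Sum>k<N. c k)"
proof -
  have "(1 - l) * (\<Sum>t<N. discounted_sum l c t) = (\<Sum>k<N. c k) - discounted_sum l c N"
    by (induction N) (simp_all add: discounted_sum_Suc distrib_left left_diff_distrib)
  then show ?thesis using discounted_sum_nonneg[of l c N] assms by simp
qed

text \<open>A product of quantities at two times is split into a part \<open>d\<close> fixed at the
  current time and a part \<open>e k\<close> that stays under the discounted sum. The geometric
  weights of \<open>d\<close> add up to at most \<open>1 / (1 - l)\<close>.\<close>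

lemma weighted_discounted_sum_le:
  assumes "0 \<le> l" "l < 1" "0 \<le> d" "\<And>k. k < t \<Longrightarrow> w * c k \<le> d + e k"
  shows "(1 - l) * (w * discounted_sum l c t) \<le> d + (1 - l) * discounted_sum l e t"
proof -
  have "w * discounted_sum l c t = (\<Sum>k<t. l ^ (t - 1 - k) * (w * c k))"
    by (simp add: discounted_sum_def sum_distrib_left mult_ac)
  also have "\<dots> \<le> (\<Sum>k<t. l ^ (t - 1 - k) * (d + e k))"
    using assms by (intro sum_mono mult_left_mono) auto
  also have "\<dots> = discounted_sum l (\<lambda>_. d) t + discounted_sum l e t"
    by (simp add: discounted_sum_def ring_distribs sum.distrib)
  also have "\<dots> \<le> d / (1 - l) + discounted_sum l e t"
    using discounted_sum_const_le[of l d t] assms by simp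
  finally have "(1 - l) * (w * discounted_sum l c t) \<le> (1 - l) * (d / (1 - l) + discounted_sum l e t)"
    using assms by (intro mult_left_mono) auto
  then show ?thesis using assms by (simp add: distrib_left)
qed

text \<open>One factor \<open>1 - l\<close> serves both parts: for \<open>d\<close> it cancels the
  geometric series over the past, for \<open>e\<close> the one over all later times, in the form of
  \<open>sum_discounted_sum_le\<close>.\<close>

lemma sum_weighted_discounted_sum_le:
  assumes "0 \<le> l" "l < 1" "\<And>t. 0 \<le> d t" "\<And>k. 0 \<le> e k"
    and "\<And>k t. k < t \<Longrightarrow> w t * c k \<le> d t + e k"
  shows "(1 - l) * (\<Sum>t<N. w t * discounted_sum l c t) \<le> (\<Sum>t<N. d t) + (\<Sum>t<N. e t)"
proof -
  have "(1 - l) * (\<Sum>t<N. w t * discounted_sum l c t) = (\<Sum>t<N. (1 - l) * (w t * discounted_sum l c t))"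
    by (simp add: sum_distrib_left)
  also have "\<dots> \<le> (\<Sum>t<N. d t + (1 - l) * discounted_sum l e t)"
    using assms by (intro sum_mono weighted_discounted_sum_le) auto
  also have "\<dots> \<le> (\<Sum>t<N. d t) + (\<Sum>t<N. e t)"
    using sum_discounted_sum_le[of l e N] assms by (simp add: sum.distrib sum_distrib_left)
  finally show ?thesis .
qed

text \<open>Nonincreasing steps allow \<open>\<alpha> t * \<alpha> k\<close> to be charged entirely
  to the earlier time \<open>k\<close>, with no share for the current time.\<close>

lemma sum_decseq_discounted_sum_le:
  assumes "0 \<le> l" "l < 1" "\<And>k. 0 \<le> \<alpha> k" "decseq \<alpha>"
  shows "(1 - l) * (\<Sum>t<N. \<alpha> t * discounted_sum l \<alpha> t) \<le> (\<Sum>t<N. (\<alpha> t)\<^sup>2)"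
proof -
  have "\<alpha> t * \<alpha> k \<le> 0 + (\<alpha> k)\<^sup>2" if "k < t" for k t
    using assms(3)[of k] decseqD[OF assms(4), of k t] that
    by (simp add: power2_eq_square mult_right_mono)
  then show ?thesis
    using sum_weighted_discounted_sum_le[of l "\<lambda>_. 0" "\<lambda>k. (\<alpha> k)\<^sup>2" \<alpha> \<alpha> N] assms by simp
qed

lemma sum_decseq_geometric_le:
  fixes \<alpha> :: "nat \<Rightarrow> real"
  assumes "0 \<le> l" "l < 1" "\<And>k. 0 \<le> \<alpha> k" "decseq \<alpha>"
  shows "(\<Sum>t<N. \<alpha> t * l ^ t) \<le> \<alpha> 0 / (1 - l)"
proof -
  have "(\<Sum>t<N. \<alpha> t * l ^ t) \<le> (\<Sum>t<N. \<alpha> 0 * l ^ t)"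
    using assms decseqD[OF assms(4), of 0] by (intro sum_mono mult_right_mono) auto
  also have "\<dots> \<le> \<alpha> 0 / (1 - l)"
    using mult_left_mono[OF sum_geometric_le[of l N], of "\<alpha> 0"] assms
    by (simp add: sum_distrib_left)
  finally show ?thesis .
qed

lemma convergent_prod_one_plus_geometric:
  fixes l D :: real
  assumes "0 \<le> l" "l < 1"
  shows "convergent_prod (\<lambda>k. 1 + D * l ^ (2 * k))"
proof -
  have "l\<^sup>2 < 1" using assms by (simp add: power_less_one_iff abs_square_less_1)
  then have "summable (\<lambda>k. \<bar>D\<bar> * (l\<^sup>2) ^ k)"
    by (intro summable_mult summable_geometric) simp
  then have "summable (\<lambda>k. norm ((1 + D * l ^ (2 * k)) - 1))"
    by (simp add: abs_mult power_mult)
  then show ?thesis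
    by (intro abs_convergent_prod_imp_convergent_prod summable_imp_abs_convergent_prod)
qed

lemma prod_le_prodinf_one_plus_geometric:
  fixes l D :: real
  assumes "0 \<le> l" "l < 1" "0 \<le> D"
  shows "(\<Prod>k<N. 1 + D * l ^ (2 * k)) \<le> (\<Prod>k. 1 + D * l ^ (2 * k))"
  using assms convergent_prod_has_prod[OF convergent_prod_one_plus_geometric[of l D]]
  by (intro prod_le_prodinf) (auto intro: add_nonneg_nonneg)

text \<open>The constant \<open>a\<close> is chosen so that \<open>D\<^sub>2 * C * \<alpha> * \<Phi> = (1 - l) * (a * \<alpha>) * (b * \<Phi>)\<close>, to which
  Young's inequality is applied.\<close>

lemma sum_Lyapunov_descent_le:
  fixes V G \<Phi> S \<Delta> \<alpha> :: "nat \<Rightarrow> real"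
  assumes l: "0 \<le> l" "l < 1"
    and nonneg: "\<And>t. 0 \<le> V t" "\<And>t. 0 \<le> G t" "\<And>t. 0 \<le> \<Phi> t" "\<And>t. 0 \<le> S t" "\<And>t. 0 \<le> \<alpha> t"
    and dec: "decseq \<alpha>"
    and const: "0 \<le> D\<^sub>1" "0 \<le> D\<^sub>2" "0 \<le> D\<^sub>3" "0 \<le> D\<^sub>4" "0 \<le> C" "0 < b"
    and a: "a = D\<^sub>2 * C / ((1 - l) * b)"
    and \<Delta>: "\<And>t. \<Delta> t = D\<^sub>4 * l ^ t + D\<^sub>1 * discounted_sum l \<alpha> t + C * discounted_sum l \<Phi> t"
    and \<Phi>: "\<And>t. b\<^sup>2 * (\<Phi> t)\<^sup>2 \<le> S t"
    and V: "\<And>t. V (Suc t) \<le> (1 + D\<^sub>1 * l ^ (2 * t)) * V t - 2 * \<alpha> t * G t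
              + D\<^sub>2 * \<alpha> t * \<Delta> t + D\<^sub>3 * (\<alpha> t)\<^sup>2 - S t"
  shows "(\<Sum>t<N. 2 * \<alpha> t * G t + S t / 2)
      \<le> (\<Prod>k. 1 + D\<^sub>1 * l ^ (2 * k)) * (V 0 + D\<^sub>2 * D\<^sub>4 * \<alpha> 0 / (1 - l)
          + (D\<^sub>2 * D\<^sub>1 / (1 - l) + (D\<^sub>3 + a\<^sup>2 / 2)) * (\<Sum>t<N. (\<alpha> t)\<^sup>2))"
proof -
  define P where "P t = (\<Prod>k<t. 1 + D\<^sub>1 * l ^ (2 * k))" for t
  define Q where "Q = (\<Prod>k. 1 + D\<^sub>1 * l ^ (2 * k))"
  \<comment> \<open>Weighting by \<open>q (Suc t)\<close> cancels the growth factor of step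
    \<open>t\<close>, so the recursion telescopes for \<open>V t * q t\<close>. The weights decrease
    and stay between \<open>inverse Q\<close> and 1.\<close>
  define q where "q t = inverse (P t)" for t
  have P_Suc: "P (Suc t) = P t * (1 + D\<^sub>1 * l ^ (2 * t))" for t by (simp add: P_def)
  have P1: "1 \<le> P t" for t using l const by (auto simp: P_def intro: prod_ge_1)
  have PQ: "P t \<le> Q" for t
    using prod_le_prodinf_one_plus_geometric l const by (simp add: P_def Q_def)
  have q: "0 < q t" "q t \<le> 1" "inverse Q \<le> q t" for t
    using P1[of t] PQ[of t] by (auto simp: q_def field_simps)
  have "incseq P"
    using P1 l const by (intro incseq_SucI) (simp add: P_Suc distrib_left order_trans[OF _ P1])
  then have qdec: "q t \<le> q k" if "k \<le> t" for k t
    using incseqD[OF _ that, of P] P1[of k] by (auto simp: q_def intro!: le_imp_inverse_le)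
  define w where "w t = q (Suc t) * \<alpha> t" for t
  have w: "0 \<le> w t" "w t \<le> \<alpha> t" for t
    using q[of "Suc t"] nonneg(5)[of t] by (auto simp: w_def mult_left_le_one_le)

  have telescope: "V N * q N + (\<Sum>t<N. q (Suc t) * (2 * \<alpha> t * G t + S t))
      \<le> V 0 + (\<Sum>t<N. D\<^sub>2 * (w t * \<Delta> t) + D\<^sub>3 * (\<alpha> t)\<^sup>2)" for N
  proof (induction N)
    case (Suc N)
    define c where "c = 1 + D\<^sub>1 * l ^ (2 * N)"
    have "c * q (Suc N) = q N"
      using l const P1[of N] by (auto simp: c_def q_def P_Suc field_simps add_nonneg_eq_0_iff)
    then have "c * (V N * q (Suc N)) = V N * q N" by (metis mult.left_commute)
    moreover have "V (Suc N) * q (Suc N) \<le> c * (V N * q (Suc N)) + q (Suc N) * (D\<^sub>3 * (\<alpha> N)\<^sup>2)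
        + D\<^sub>2 * (w N * \<Delta> N) - q (Suc N) * (2 * \<alpha> N * G N + S N)"
      using mult_right_mono[OF V[of N, folded c_def] less_imp_le[OF q(1)[of "Suc N"]]]
      by (simp add: algebra_simps w_def)
    moreover have "q (Suc N) * (D\<^sub>3 * (\<alpha> N)\<^sup>2) \<le> D\<^sub>3 * (\<alpha> N)\<^sup>2"
      using q[of "Suc N"] const by (intro mult_left_le_one_le) auto
    ultimately show ?case using Suc unfolding sum.lessThan_Suc by linarith
  qed (simp add: q_def P_def)

  have geo: "(\<Sum>t<N. w t * l ^ t) \<le> \<alpha> 0 / (1 - l)"
    using sum_decseq_geometric_le[OF l nonneg(5) dec, of N]
    by (rule order_trans[rotated]) (use w l in \<open>auto intro!: sum_mono mult_right_mono\<close>)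
  have step: "(\<Sum>t<N. w t * discounted_sum l \<alpha> t) \<le> (\<Sum>t<N. (\<alpha> t)\<^sup>2) / (1 - l)"
  proof -
    have "(\<Sum>t<N. w t * discounted_sum l \<alpha> t) \<le> (\<Sum>t<N. \<alpha> t * discounted_sum l \<alpha> t)"
      using w l nonneg by (intro sum_mono mult_right_mono discounted_sum_nonneg) auto
    also have "\<dots> \<le> (\<Sum>t<N. (\<alpha> t)\<^sup>2) / (1 - l)"
      using sum_decseq_discounted_sum_le[OF l nonneg(5) dec, of N] l
      by (simp add: pos_le_divide_eq mult.commute)
    finally show ?thesis .
  qed
  have res: "D\<^sub>2 * C * (\<Sum>t<N. w t * discounted_sum l \<Phi> t)
      \<le> a\<^sup>2 / 2 * (\<Sum>t<N. (\<alpha> t)\<^sup>2) + (\<Sum>t<N. q (Suc t) * S t / 2)"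
  proof -
    have "(1 - l) * (\<Sum>t<N. (a * b * w t) * discounted_sum l \<Phi> t)
        \<le> (\<Sum>t<N. a\<^sup>2 / 2 * (\<alpha> t)\<^sup>2) + (\<Sum>t<N. q (Suc t) * S t / 2)"
    proof (intro sum_weighted_discounted_sum_le l)
      fix k t :: nat assume "k < t"
      \<comment> \<open>The half containing \<open>b * \<Phi> k\<close> must be paid by
        \<open>S k\<close>, which carries the weight of step \<open>k\<close>. Since
        \<open>q\<close> decreases, the weight \<open>q (Suc t)\<close> may be raised to
        \<open>q (Suc k)\<close>.\<close>
      then have *: "q (Suc t) \<le> q (Suc k)" "0 < q (Suc t)" "q (Suc t) \<le> 1"
        using qdec[of "Suc k" "Suc t"] q by auto
      have "a * b * w t * \<Phi> k = q (Suc t) * ((a * \<alpha> t) * (b * \<Phi> k))"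
        by (simp add: w_def)
      also have "\<dots> \<le> q (Suc t) * ((a * \<alpha> t)\<^sup>2 / 2 + (b * \<Phi> k)\<^sup>2 / 2)"
        using * sum_squares_bound[of "a * \<alpha> t" "b * \<Phi> k"] by (intro mult_left_mono) auto
      also have "\<dots> \<le> 1 * ((a * \<alpha> t)\<^sup>2 / 2) + q (Suc k) * ((b * \<Phi> k)\<^sup>2 / 2)"
        unfolding distrib_left using * by (intro add_mono mult_right_mono) auto
      also have "\<dots> \<le> a\<^sup>2 / 2 * (\<alpha> t)\<^sup>2 + q (Suc k) * S k / 2"
        using mult_left_mono[OF \<Phi>[of k] less_imp_le[OF q(1)[of "Suc k"]]]
        by (simp add: power_mult_distrib)
      finally show "a * b * w t * \<Phi> k \<le> a\<^sup>2 / 2 * (\<alpha> t)\<^sup>2 + q (Suc k) * S k / 2" .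
    qed (use nonneg less_imp_le[OF q(1)] in auto)
    moreover have "(1 - l) * (\<Sum>t<N. (a * b * w t) * discounted_sum l \<Phi> t)
        = ((1 - l) * (a * b)) * (\<Sum>t<N. w t * discounted_sum l \<Phi> t)"
      by (simp add: sum_distrib_left mult_ac)
    moreover have "(1 - l) * (a * b) = D\<^sub>2 * C" using l const by (simp add: a)
    ultimately show ?thesis by (simp add: sum_distrib_left)
  qed

  have "(\<Sum>t<N. D\<^sub>2 * (w t * \<Delta> t)) = D\<^sub>2 * D\<^sub>4 * (\<Sum>t<N. w t * l ^ t)
      + D\<^sub>2 * D\<^sub>1 * (\<Sum>t<N. w t * discounted_sum l \<alpha> t)
      + D\<^sub>2 * C * (\<Sum>t<N. w t * discounted_sum l \<Phi> t)"
    unfolding sum_distrib_left sum.distrib[symmetric] \<Delta>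
    by (intro sum.cong) (auto simp: algebra_simps)
  also have "\<dots> \<le> D\<^sub>2 * D\<^sub>4 * (\<alpha> 0 / (1 - l)) + D\<^sub>2 * D\<^sub>1 * ((\<Sum>t<N. (\<alpha> t)\<^sup>2) / (1 - l))
      + (a\<^sup>2 / 2 * (\<Sum>t<N. (\<alpha> t)\<^sup>2) + (\<Sum>t<N. q (Suc t) * S t / 2))"
    using geo step res const by (intro add_mono mult_left_mono) auto
  finally have \<Delta>_sum: "(\<Sum>t<N. D\<^sub>2 * (w t * \<Delta> t)) \<le> \<dots>" .
  \<comment> \<open>Half of the \<open>S\<close> terms cancels against those produced by Young's
    inequality; the other half remains in the conclusion.\<close>
  have "(\<Sum>t<N. q (Suc t) * (2 * \<alpha> t * G t + S t))
      = (\<Sum>t<N. q (Suc t) * (2 * \<alpha> t * G t + S t / 2)) + (\<Sum>t<N. q (Suc t) * S t / 2)"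
    unfolding sum.distrib[symmetric] by (intro sum.cong) (auto simp: algebra_simps)
  moreover have "0 \<le> V N * q N" using nonneg(1)[of N] q(1)[of N] by simp
  moreover have "(\<Sum>t<N. D\<^sub>2 * (w t * \<Delta> t) + D\<^sub>3 * (\<alpha> t)\<^sup>2)
      = (\<Sum>t<N. D\<^sub>2 * (w t * \<Delta> t)) + D\<^sub>3 * (\<Sum>t<N. (\<alpha> t)\<^sup>2)"
    by (simp add: sum.distrib sum_distrib_left)
  ultimately have "(\<Sum>t<N. q (Suc t) * (2 * \<alpha> t * G t + S t / 2))
      \<le> V 0 + D\<^sub>2 * D\<^sub>4 * (\<alpha> 0 / (1 - l)) + D\<^sub>2 * D\<^sub>1 * ((\<Sum>t<N. (\<alpha> t)\<^sup>2) / (1 - l))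
        + a\<^sup>2 / 2 * (\<Sum>t<N. (\<alpha> t)\<^sup>2) + D\<^sub>3 * (\<Sum>t<N. (\<alpha> t)\<^sup>2)"
    using telescope[of N] \<Delta>_sum by linarith
  then have "(\<Sum>t<N. q (Suc t) * (2 * \<alpha> t * G t + S t / 2))
      \<le> V 0 + D\<^sub>2 * D\<^sub>4 * \<alpha> 0 / (1 - l)
          + (D\<^sub>2 * D\<^sub>1 / (1 - l) + (D\<^sub>3 + a\<^sup>2 / 2)) * (\<Sum>t<N. (\<alpha> t)\<^sup>2)" (is "_ \<le> ?B")
    by (simp add: distrib_right add_ac)
  \<comment> \<open>All summands are nonnegative, so the common lower bound \<open>inverse Q\<close>
    of the weights restores the unweighted sum at the price of a factor \<open>Q\<close>.\<close>
  moreover have "inverse Q * (\<Sum>t<N. 2 * \<alpha> t * G t + S t / 2)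
      \<le> (\<Sum>t<N. q (Suc t) * (2 * \<alpha> t * G t + S t / 2))"
    unfolding sum_distrib_left using nonneg q by (intro sum_mono mult_right_mono) auto
  ultimately have "inverse Q * (\<Sum>t<N. 2 * \<alpha> t * G t + S t / 2) \<le> ?B" by linarith
  then show ?thesis
    using P1[of 0] PQ[of 0] by (fold Q_def) (simp add: field_simps)
qed

subsection \<open>Perturbed averaging\<close>

text \<open>\<open>matpow\<close> appends factors on the right, whereas the averaging step applies
  the matrix on the left.\<close>

lemma matpow_commute: "matpow A t ** A = A ** matpow A t"
  by (induction t) (simp_all, metis matrix_mul_assoc)

text \<open>Discrete variation of constants: by linearity each perturbation is propagated separately
  by the averaging steps after it.\<close>

lemma perturbed_averaging_unfold:
  fixes x e :: "nat \<Rightarrow> 'n::finite \<Rightarrow> 'a::real_vector"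
  assumes "\<And>t i. x (Suc t) i = (\<Sum>j\<in>UNIV. W $ i $ j *\<^sub>R x t j) + e t i"
  shows "x t i = (\<Sum>j\<in>UNIV. matpow W t $ i $ j *\<^sub>R x 0 j)
    + (\<Sum>k<t. \<Sum>j\<in>UNIV. matpow W (t - 1 - k) $ i $ j *\<^sub>R e k j)"
proof (induction t arbitrary: i)
  case 0
  show ?case by (simp add: mat_def if_distrib[of "\<lambda>c. c *\<^sub>R _"] cong: if_cong)
next
  case (Suc t)
  have W: "(\<Sum>l\<in>UNIV. W $ i $ l *\<^sub>R (\<Sum>j\<in>UNIV. matpow W m $ l $ j *\<^sub>R y j))
      = (\<Sum>j\<in>UNIV. matpow W (Suc m) $ i $ j *\<^sub>R y j)" for m and y :: "'n \<Rightarrow> 'a"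
    unfolding matpow.simps matpow_commute
    by (simp add: matrix_matrix_mult_def scaleR_sum_right scaleR_sum_left) (rule sum.swap)
  have "x (Suc t) i = (\<Sum>l\<in>UNIV. W $ i $ l *\<^sub>R (\<Sum>j\<in>UNIV. matpow W t $ l $ j *\<^sub>R x 0 j))
      + (\<Sum>k<t. \<Sum>l\<in>UNIV. W $ i $ l *\<^sub>R (\<Sum>j\<in>UNIV. matpow W (t - 1 - k) $ l $ j *\<^sub>R e k j)) + e t i"
    unfolding assms Suc scaleR_right_distrib sum.distrib scaleR_sum_right[of _ _ "{..<t}"]
    by (subst sum.swap) simp
  also have "\<dots> = (\<Sum>j\<in>UNIV. matpow W (Suc t) $ i $ j *\<^sub>R x 0 j)
      + (\<Sum>k<t. \<Sum>j\<in>UNIV. matpow W (Suc t - 1 - k) $ i $ j *\<^sub>R e k j)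
      + (\<Sum>j\<in>UNIV. matpow W 0 $ i $ j *\<^sub>R e t j)"
    unfolding W by (simp add: mat_def Suc_diff_Suc if_distrib[of "\<lambda>c. c *\<^sub>R _"] cong: if_cong)
  finally show ?case by simp
qed

text \<open>A left eigenvector with eigenvalue 1 makes the weighted mean invariant under averaging,
  so perturbations accumulate in it without damping.\<close>

lemma perturbed_averaging_mean:
  fixes x e :: "nat \<Rightarrow> 'n::finite \<Rightarrow> 'a::real_vector"
  assumes "\<And>t i. x (Suc t) i = (\<Sum>j\<in>UNIV. W $ i $ j *\<^sub>R x t j) + e t i"
    and \<pi>: "\<And>j. (\<Sum>i\<in>UNIV. \<pi> $ i * W $ i $ j) = \<pi> $ j"
  shows "(\<Sum>i\<in>UNIV. \<pi> $ i *\<^sub>R x t i)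
    = (\<Sum>j\<in>UNIV. \<pi> $ j *\<^sub>R x 0 j) + (\<Sum>k<t. \<Sum>j\<in>UNIV. \<pi> $ j *\<^sub>R e k j)"
proof (induction t)
  case (Suc t)
  have "(\<Sum>i\<in>UNIV. \<pi> $ i *\<^sub>R (\<Sum>j\<in>UNIV. W $ i $ j *\<^sub>R x t j)) = (\<Sum>j\<in>UNIV. \<pi> $ j *\<^sub>R x t j)"
    unfolding scaleR_sum_right by (subst sum.swap) (simp add: \<pi> flip: scaleR_sum_left)
  then show ?case by (simp add: assms(1) scaleR_right_distrib sum.distrib Suc)
qed simp

text \<open>Subtracting the mean from the unfolded iterate replaces each entry of a matrix power by
  its deviation from \<open>\<pi> $ j\<close>; the geometric bound on the deviations produces the
  discounted sum.\<close>

lemma perturbed_averaging_consensus: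
  fixes x e :: "nat \<Rightarrow> 'n::finite \<Rightarrow> 'a::real_normed_vector"
  assumes rec: "\<And>t i. x (Suc t) i = (\<Sum>j\<in>UNIV. W $ i $ j *\<^sub>R x t j) + e t i"
    and \<pi>: "\<And>j. (\<Sum>i\<in>UNIV. \<pi> $ i * W $ i $ j) = \<pi> $ j"
    and W: "\<And>t i j. \<bar>matpow W t $ i $ j - \<pi> $ j\<bar> \<le> C * l ^ t"
  shows "norm (x t i - (\<Sum>j\<in>UNIV. \<pi> $ j *\<^sub>R x t j))
    \<le> C * (\<Sum>j\<in>UNIV. norm (x 0 j)) * l ^ t + C * discounted_sum l (\<lambda>k. \<Sum>j\<in>UNIV. norm (e k j)) t"
proof -
  have *: "norm (\<Sum>j\<in>UNIV. (matpow W m $ i $ j - \<pi> $ j) *\<^sub>R y j) \<le> C * l ^ m * (\<Sum>j\<in>UNIV. norm (y j))"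
    for m and y :: "'n \<Rightarrow> 'a"
    unfolding sum_distrib_left using W by (intro sum_norm_le) (simp add: mult_right_mono)
  have "x t i - (\<Sum>j\<in>UNIV. \<pi> $ j *\<^sub>R x t j)
      = (\<Sum>j\<in>UNIV. (matpow W t $ i $ j - \<pi> $ j) *\<^sub>R x 0 j)
        + (\<Sum>k<t. \<Sum>j\<in>UNIV. (matpow W (t - 1 - k) $ i $ j - \<pi> $ j) *\<^sub>R e k j)"
    unfolding perturbed_averaging_mean[where x = x and e = e and W = W and t = t, OF rec \<pi>]
      perturbed_averaging_unfold[where x = x and e = e and W = W and t = t and i = i, OF rec]
    by (simp add: scaleR_left_diff_distrib sum_subtractf)
  also have "norm \<dots> \<le> C * l ^ t * (\<Sum>j\<in>UNIV. norm (x 0 j))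
      + (\<Sum>k<t. C * l ^ (t - 1 - k) * (\<Sum>j\<in>UNIV. norm (e k j)))"
    by (intro norm_triangle_mono sum_norm_le *)
  finally show ?thesis by (simp add: discounted_sum_def sum_distrib_left mult_ac)
qed

subsection \<open>One step of the algorithms\<close>

text \<open>Passing to function values at \<open>p i\<close> before replacing \<open>p i\<close> by \<open>m\<close> keeps the weight
  \<open>\<pi> i / z i \<le> \<eta> * \<pi> i\<close> on the distances \<open>norm (p i - m)\<close>, so that they contribute
  \<open>L * \<eta> * \<Delta>\<close> without a factor for the number of agents.\<close>

lemma weighted_subgradient_inner_le:
  fixes f :: "'n::finite \<Rightarrow> 'a::real_inner \<Rightarrow> real"
  assumes g: "\<And>i. g i \<in> subdifferential (f i) (p i)"
    and lip: "\<And>i u v. u \<in> U \<Longrightarrow> v \<in> U \<Longrightarrow> \<bar>f i u - f i v\<bar> \<le> L * norm (u - v)"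
    and U: "\<And>i. p i \<in> U" "m \<in> U" "s \<in> U" "y \<in> U"
    and L: "0 \<le> L" and \<eta>: "0 < \<eta>"
    and \<pi>: "\<And>i. 0 \<le> \<pi> i" "(\<Sum>i\<in>UNIV. \<pi> i) = 1"
    and z: "\<And>i. inverse \<eta> \<le> z i" "\<And>i. \<bar>z i - \<pi> i\<bar> \<le> \<epsilon>"
    and \<Delta>: "\<And>i. norm (p i - m) \<le> \<Delta>"
  shows "- (\<Sum>i\<in>UNIV. \<pi> i / z i * (g i \<bullet> (p i - y)))
    \<le> L * \<eta> * \<Delta> + real CARD('n) * (\<eta> * \<epsilon> * L * norm (m - y) + L * norm (m - s))
      - ((\<Sum>i\<in>UNIV. f i s) - (\<Sum>i\<in>UNIV. f i y))"
proof -
  have "- (\<pi> i / z i * (g i \<bullet> (p i - y)))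
      \<le> \<pi> i * (L * \<eta> * \<Delta>) + \<eta> * \<epsilon> * L * norm (m - y) + L * norm (m - s) - (f i s - f i y)" for i
  proof -
    define \<rho> where "\<rho> = \<pi> i / z i"
    have zi: "0 < z i" using z(1)[of i] \<eta> by (smt (verit) inverse_positive_iff_positive)
    have inv: "inverse (z i) \<le> \<eta>"
      using le_imp_inverse_le[OF z(1)[of i]] \<eta> by simp
    have \<rho>: "0 \<le> \<rho>" "\<rho> \<le> \<pi> i * \<eta>"
      using \<pi>(1)[of i] zi inv by (auto simp: \<rho>_def divide_inverse mult_left_mono)
    have "\<bar>1 - \<rho>\<bar> = \<bar>z i - \<pi> i\<bar> * inverse (z i)"
      using zi by (simp add: \<rho>_def field_simps abs_divide)
    also have "\<dots> \<le> \<epsilon> * \<eta>" using z(2)[of i] inv zi by (intro mult_mono) auto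
    finally have \<rho>1: "\<bar>1 - \<rho>\<bar> \<le> \<eta> * \<epsilon>" by (simp add: mult.commute)
    have "- (g i \<bullet> (p i - y)) \<le> f i y - f i (p i)"
      using g[of i] by (simp add: subdifferential_def inner_diff_right) (smt (verit))
    then have "- (\<rho> * (g i \<bullet> (p i - y))) \<le> \<rho> * (f i y - f i (p i))"
      using mult_left_mono[OF _ \<rho>(1)] by fastforce
    \<comment> \<open>The gap \<open>f i s - f i y\<close> has to appear with weight 1 rather than
      \<open>\<rho>\<close>. The discrepancy is placed on \<open>f i m - f i y\<close>, where the
      error of \<open>z i\<close> is multiplied by \<open>norm (m - y)\<close>, a distance that the
      Lyapunov function controls.\<close>
    also have "\<dots> = \<rho> * (f i m - f i (p i)) + (1 - \<rho>) * (f i m - f i y) + (f i s - f i m) - (f i s - f i y)"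
      by (simp add: algebra_simps)
    also have "\<rho> * (f i m - f i (p i)) \<le> \<pi> i * \<eta> * (L * \<Delta>)"
    proof -
      have "f i m - f i (p i) \<le> L * norm (p i - m)"
        using lip[OF U(2) U(1), of i i] by (simp add: norm_minus_commute)
      also have "\<dots> \<le> L * \<Delta>" using \<Delta> L by (intro mult_left_mono) auto
      finally have "\<rho> * (f i m - f i (p i)) \<le> \<rho> * (L * \<Delta>)" using \<rho> by (intro mult_left_mono)
      also have "\<dots> \<le> \<pi> i * \<eta> * (L * \<Delta>)"
        using \<rho> L order_trans[OF norm_ge_zero \<Delta>[of i]] by (intro mult_right_mono) auto
      finally show ?thesis .
    qed
    also have "(1 - \<rho>) * (f i m - f i y) \<le> \<eta> * \<epsilon> * (L * norm (m - y))"
    proof -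
      have "(1 - \<rho>) * (f i m - f i y) \<le> \<bar>1 - \<rho>\<bar> * \<bar>f i m - f i y\<bar>"
        by (metis abs_ge_self abs_mult)
      also have "\<dots> \<le> \<eta> * \<epsilon> * (L * norm (m - y))"
        using \<rho>1 lip[OF U(2,4)] by (intro mult_mono) auto
      finally show ?thesis .
    qed
    also have "f i s - f i m \<le> L * norm (m - s)"
      using lip[OF U(2,3), of i] by linarith
    finally show ?thesis by (simp add: \<rho>_def mult_ac)
  qed
  then have "(\<Sum>i\<in>UNIV. - (\<pi> i / z i * (g i \<bullet> (p i - y))))
      \<le> (\<Sum>i\<in>UNIV. \<pi> i * (L * \<eta> * \<Delta>) + \<eta> * \<epsilon> * L * norm (m - y) + L * norm (m - s) - (f i s - f i y))"
    by (intro sum_mono)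
  then show ?thesis
    by (simp add: sum_negf sum.distrib sum_subtractf \<pi>(2) distrib_left flip: sum_distrib_right)
qed

text \<open>Jensen's inequality in each row, after which invariance of \<open>\<pi>\<close> under
  \<open>W\<close> collapses the double sum.\<close>

lemma sum_norm_sq_averaging_le:
  fixes u :: "'n::finite \<Rightarrow> 'a::real_inner"
  assumes "\<And>i j. 0 \<le> W $ i $ j" "\<And>i. (\<Sum>j\<in>UNIV. W $ i $ j) = 1"
    and "\<And>i. 0 \<le> \<pi> $ i" "\<And>j. (\<Sum>i\<in>UNIV. \<pi> $ i * W $ i $ j) = \<pi> $ j"
  shows "(\<Sum>i\<in>UNIV. \<pi> $ i * (norm (\<Sum>j\<in>UNIV. W $ i $ j *\<^sub>R u j))\<^sup>2)
    \<le> (\<Sum>j\<in>UNIV. \<pi> $ j * (norm (u j))\<^sup>2)"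
proof -
  have "(\<Sum>i\<in>UNIV. \<pi> $ i * (norm (\<Sum>j\<in>UNIV. W $ i $ j *\<^sub>R u j))\<^sup>2)
      \<le> (\<Sum>i\<in>UNIV. \<pi> $ i * (\<Sum>j\<in>UNIV. W $ i $ j * (norm (u j))\<^sup>2))"
    using assms by (intro sum_mono mult_left_mono norm_sq_convex_combination) auto
  also have "\<dots> = (\<Sum>j\<in>UNIV. (\<Sum>i\<in>UNIV. \<pi> $ i * W $ i $ j) * (norm (u j))\<^sup>2)"
    unfolding sum_distrib_left sum_distrib_right by (subst sum.swap) (simp add: mult_ac)
  finally show ?thesis using assms(4) by simp
qed

lemma norm_sq_subgradient_step_le:
  fixes p g y :: "'a::real_inner"
  assumes "norm ((\<alpha> / z) *\<^sub>R g) \<le> \<beta>"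
  shows "(norm (p - (\<alpha> / z) *\<^sub>R g - y))\<^sup>2 \<le> (norm (p - y))\<^sup>2 - 2 * \<alpha> * (g \<bullet> (p - y) / z) + \<beta>\<^sup>2"
proof -
  have "(norm (p - h - y))\<^sup>2 = (norm (p - y))\<^sup>2 - 2 * (h \<bullet> (p - y)) + (norm h)\<^sup>2" for h
    unfolding power2_norm_eq_inner by (simp add: algebra_simps inner_commute)
  from this[of "(\<alpha> / z) *\<^sub>R g"] show ?thesis using power_mono[OF assms, of 2] by simp
qed

lemma norm_scaled_subgradient_le:
  fixes g :: "'a::real_normed_vector"
  assumes "norm g \<le> L" "0 \<le> \<alpha>" "0 < \<eta>" "inverse \<eta> \<le> z"
  shows "norm ((\<alpha> / z) *\<^sub>R g) \<le> \<alpha> * L * \<eta>"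
proof -
  have "0 < z" using assms by (smt (verit) inverse_positive_iff_positive)
  then have "\<alpha> / z \<le> \<alpha> * \<eta>"
    using le_imp_inverse_le[OF assms(4)] assms by (simp add: divide_inverse mult_left_mono)
  then show ?thesis
    using mult_mono[of "\<alpha> / z" "\<alpha> * \<eta>" "norm g" L] assms \<open>0 < z\<close> by (simp add: mult_ac)
qed

text \<open>Both algorithms are instances of one scheme: \<open>p t i\<close> is the point at which agent \<open>i\<close>
  evaluates its subgradient, and \<open>\<phi> t i\<close> is the displacement caused by its projection.\<close>

lemma algorithms_descent:
  fixes X :: "'n::finite \<Rightarrow> (real^'m) set"
  assumes W: "\<And>i j. 0 \<le> W $ i $ j" "\<And>i. (\<Sum>j\<in>UNIV. W $ i $ j) = 1"
    and \<pi>: "\<And>i. 0 \<le> \<pi> $ i" "(\<Sum>i\<in>UNIV. \<pi> $ i) = 1" "\<And>j. (\<Sum>i\<in>UNIV. \<pi> $ i * W $ i $ j) = \<pi> $ j"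
    and X: "\<And>i. closed (X i)" "\<And>i. convex (X i)" "(\<Inter>i. X i) \<noteq> {}" "\<And>i. x 0 i \<in> X i"
    and L: "\<forall>i. \<forall>y\<in>convex hull (\<Union>i. X i). \<forall>h\<in>subdifferential (f i) y. norm h \<le> L"
    and z: "0 < \<eta>" "\<And>i t. inverse \<eta> \<le> zseq W t i $ i"
    and \<alpha>: "\<And>t. 0 \<le> \<alpha> t"
    and alg: "algorithm1 W X f \<alpha> g x \<or> algorithm2 W X f \<alpha> g x"
  obtains p and \<phi> :: "nat \<Rightarrow> 'n \<Rightarrow> real^'m" where
    "\<And>t i. x t i \<in> X i"
    "\<And>t i. p t i \<in> convex hull (range (x t))"
    "\<And>t i. g t i \<in> subdifferential (f i) (p t i)"
    "\<And>t i. norm (x (Suc t) i - (\<Sum>j\<in>UNIV. W $ i $ j *\<^sub>R x t j)) \<le> norm (\<phi> t i) + \<alpha> t * L * \<eta>"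
    "\<And>t y. y \<in> (\<Inter>i. X i) \<Longrightarrow> (\<Sum>i\<in>UNIV. \<pi> $ i * (norm (x (Suc t) i - y))\<^sup>2)
      \<le> (\<Sum>i\<in>UNIV. \<pi> $ i * (norm (x t i - y))\<^sup>2)
        - 2 * \<alpha> t * (\<Sum>i\<in>UNIV. \<pi> $ i / zseq W t i $ i * (g t i \<bullet> (p t i - y)))
        + (\<alpha> t * L * \<eta>)\<^sup>2 - (\<Sum>i\<in>UNIV. \<pi> $ i * (norm (\<phi> t i))\<^sup>2)"
proof -
  define v where "v t i = (\<Sum>j\<in>UNIV. W $ i $ j *\<^sub>R x t j)" for t i
  have xX: "x t i \<in> X i" for t i
  proof (cases t)
    case (Suc t)
    have "X i \<noteq> {}" using X(3) by blast
    then show ?thesis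
      using alg Suc closest_point_in_set[OF X(1) \<open>X i \<noteq> {}\<close>] by (auto simp: algorithm1_def algorithm2_def)
  qed (use X in simp)
  have v_hull: "v t i \<in> convex hull (range (x t))" for t i
    unfolding v_def using W by (intro convex_sum) (auto intro: hull_inc)
  have hull_U: "convex hull (range (x t)) \<subseteq> convex hull (\<Union>i. X i)" for t
    using xX by (intro hull_mono) blast
  have avg_diff: "(\<Sum>j\<in>UNIV. W $ i $ j *\<^sub>R (u j - y)) = (\<Sum>j\<in>UNIV. W $ i $ j *\<^sub>R u j) - y"
    for i y and u :: "'n \<Rightarrow> real^'m"
    by (simp add: scaleR_right_diff_distrib sum_subtractf W(2) flip: scaleR_sum_left)
  have avg: "(\<Sum>i\<in>UNIV. \<pi> $ i * (norm ((\<Sum>j\<in>UNIV. W $ i $ j *\<^sub>R u j) - y))\<^sup>2)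
      \<le> (\<Sum>i\<in>UNIV. \<pi> $ i * (norm (u i - y))\<^sup>2)" for y and u :: "'n \<Rightarrow> real^'m"
    using sum_norm_sq_averaging_le[OF W \<pi>(1,3), of "\<lambda>j. u j - y"] by (simp add: avg_diff)
  have step: "(\<Sum>i\<in>UNIV. \<pi> $ i * (norm (p i - (\<alpha> t / zseq W t i $ i) *\<^sub>R g t i - y))\<^sup>2)
      \<le> (\<Sum>i\<in>UNIV. \<pi> $ i * (norm (p i - y))\<^sup>2)
        - 2 * \<alpha> t * (\<Sum>i\<in>UNIV. \<pi> $ i / zseq W t i $ i * (g t i \<bullet> (p i - y))) + (\<alpha> t * L * \<eta>)\<^sup>2"
    if "\<And>i. norm (g t i) \<le> L" for p y t
  proof -
    have "(\<Sum>i\<in>UNIV. \<pi> $ i * (norm (p i - (\<alpha> t / zseq W t i $ i) *\<^sub>R g t i - y))\<^sup>2)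
      \<le> (\<Sum>i\<in>UNIV. \<pi> $ i * ((norm (p i - y))\<^sup>2 - 2 * \<alpha> t * (g t i \<bullet> (p i - y) / zseq W t i $ i)
          + (\<alpha> t * L * \<eta>)\<^sup>2))"
      using \<pi>(1) that \<alpha> z
      by (intro sum_mono mult_left_mono norm_sq_subgradient_step_le norm_scaled_subgradient_le) auto
    also have "\<dots> = (\<Sum>i\<in>UNIV. \<pi> $ i * (norm (p i - y))\<^sup>2)
        - 2 * \<alpha> t * (\<Sum>i\<in>UNIV. \<pi> $ i / zseq W t i $ i * (g t i \<bullet> (p i - y)))
        + (\<Sum>i\<in>UNIV. \<pi> $ i) * (\<alpha> t * L * \<eta>)\<^sup>2"
      by (simp add: distrib_left right_diff_distrib sum.distrib sum_subtractf sum_distrib_left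
          sum_distrib_right mult_ac)
    finally show ?thesis by (simp add: \<pi>(2))
  qed
  have proj: "(\<Sum>i\<in>UNIV. \<pi> $ i * (norm (x (Suc t) i - y))\<^sup>2)
      \<le> (\<Sum>i\<in>UNIV. \<pi> $ i * (norm (u i - y))\<^sup>2)
        - (\<Sum>i\<in>UNIV. \<pi> $ i * (norm (x (Suc t) i - u i))\<^sup>2)"
    if "\<And>i. x (Suc t) i = closest_point (X i) (u i)" "y \<in> (\<Inter>i. X i)" for t u y
    unfolding sum_subtractf[symmetric] right_diff_distrib[symmetric] that(1)
    using \<pi>(1) that(2) X by (intro sum_mono mult_left_mono closest_point_Pythagoras) auto
  from alg show thesis
  proof
    assume "algorithm1 W X f \<alpha> g x"
    then have g: "g t i \<in> subdifferential (f i) (v t i)"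
      and x: "x (Suc t) i = closest_point (X i) (v t i - (\<alpha> t / zseq W t i $ i) *\<^sub>R g t i)" for t i
      by (auto simp: algorithm1_def v_def)
    have gL: "norm (g t i) \<le> L" for t i using L g v_hull hull_U by blast
    \<comment> \<open>The residual is measured from the point that is projected, so the subgradient
      displacement is not part of it.\<close>
    define \<phi> where "\<phi> t i = x (Suc t) i - (v t i - (\<alpha> t / zseq W t i $ i) *\<^sub>R g t i)" for t i
    show thesis
    proof (rule that[of v \<phi>, OF xX v_hull g])
      fix t i
      have "x (Suc t) i - v t i = \<phi> t i - (\<alpha> t / zseq W t i $ i) *\<^sub>R g t i" by (simp add: \<phi>_def)
      moreover have "norm ((\<alpha> t / zseq W t i $ i) *\<^sub>R g t i) \<le> \<alpha> t * L * \<eta>"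
        by (intro norm_scaled_subgradient_le gL \<alpha> z)
      ultimately show "norm (x (Suc t) i - (\<Sum>j\<in>UNIV. W $ i $ j *\<^sub>R x t j)) \<le> norm (\<phi> t i) + \<alpha> t * L * \<eta>"
        unfolding v_def[symmetric] by (simp add: order_trans[OF norm_triangle_ineq4 add_left_mono])
    next
      fix t y assume "y \<in> (\<Inter>i. X i)"
      then show "(\<Sum>i\<in>UNIV. \<pi> $ i * (norm (x (Suc t) i - y))\<^sup>2)
          \<le> (\<Sum>i\<in>UNIV. \<pi> $ i * (norm (x t i - y))\<^sup>2)
            - 2 * \<alpha> t * (\<Sum>i\<in>UNIV. \<pi> $ i / zseq W t i $ i * (g t i \<bullet> (v t i - y)))
            + (\<alpha> t * L * \<eta>)\<^sup>2 - (\<Sum>i\<in>UNIV. \<pi> $ i * (norm (\<phi> t i))\<^sup>2)"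
        \<comment> \<open>The iteration is undone in reverse order: projection, subgradient step
          from \<open>v t\<close>, averaging of \<open>x t\<close>.\<close>
        using proj[OF x, where y = y and t = t]
          step[OF gL, where t = t and p = "v t" and y = y]
          avg[where u = "x t" and y = y]
        unfolding \<phi>_def[symmetric] v_def[symmetric] by linarith
    qed
  next
    assume "algorithm2 W X f \<alpha> g x"
    then have g: "g t i \<in> subdifferential (f i) (x t i)"
      and x: "x (Suc t) i = closest_point (X i)
        (\<Sum>j\<in>UNIV. W $ i $ j *\<^sub>R (x t j - (\<alpha> t / zseq W t j $ j) *\<^sub>R g t j))" for t i
      by (auto simp: algorithm2_def)
    have x_hull: "x t i \<in> convex hull (range (x t))" for t i by (simp add: hull_inc)
    have gL: "norm (g t i) \<le> L" for t i using L g x_hull hull_U by blast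
    define h where "h t j = (\<alpha> t / zseq W t j $ j) *\<^sub>R g t j" for t j
    have h: "norm (h t j) \<le> \<alpha> t * L * \<eta>" for t j
      unfolding h_def by (intro norm_scaled_subgradient_le gL \<alpha> z)
    define \<phi> where "\<phi> t i = x (Suc t) i - (\<Sum>j\<in>UNIV. W $ i $ j *\<^sub>R (x t j - h t j))" for t i
    show thesis
    proof (rule that[of x \<phi>, OF xX x_hull g])
      fix t i
      \<comment> \<open>The steps of several agents are averaged here; unit row sums preserve the
        bound of a single step.\<close>
      have "norm (\<Sum>j\<in>UNIV. W $ i $ j *\<^sub>R h t j) \<le> (\<Sum>j\<in>UNIV. W $ i $ j * (\<alpha> t * L * \<eta>))"
        using W(1) h by (intro sum_norm_le) (simp add: mult_left_mono)
      then have "norm (\<Sum>j\<in>UNIV. W $ i $ j *\<^sub>R h t j) \<le> \<alpha> t * L * \<eta>"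
        by (simp add: W(2) flip: sum_distrib_right)
      moreover have "x (Suc t) i - v t i = \<phi> t i - (\<Sum>j\<in>UNIV. W $ i $ j *\<^sub>R h t j)"
        by (simp add: \<phi>_def v_def scaleR_right_diff_distrib sum_subtractf)
      ultimately show "norm (x (Suc t) i - (\<Sum>j\<in>UNIV. W $ i $ j *\<^sub>R x t j)) \<le> norm (\<phi> t i) + \<alpha> t * L * \<eta>"
        unfolding v_def[symmetric] by (simp add: order_trans[OF norm_triangle_ineq4 add_left_mono])
    next
      fix t y assume "y \<in> (\<Inter>i. X i)"
      then show "(\<Sum>i\<in>UNIV. \<pi> $ i * (norm (x (Suc t) i - y))\<^sup>2)
          \<le> (\<Sum>i\<in>UNIV. \<pi> $ i * (norm (x t i - y))\<^sup>2)
            - 2 * \<alpha> t * (\<Sum>i\<in>UNIV. \<pi> $ i / zseq W t i $ i * (g t i \<bullet> (x t i - y)))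
            + (\<alpha> t * L * \<eta>)\<^sup>2 - (\<Sum>i\<in>UNIV. \<pi> $ i * (norm (\<phi> t i))\<^sup>2)"
        \<comment> \<open>Averaging came after the subgradient steps, so it is undone before them,
          and the steps start at \<open>x t\<close>.\<close>
        using proj[OF x, where y = y and t = t]
          step[OF gL, where t = t and p = "x t" and y = y]
          avg[where u = "\<lambda>j. x t j - h t j" and y = y]
        unfolding \<phi>_def[symmetric] h_def[symmetric] by linarith
    qed
  qed
qed

subsection \<open>The convergence rate\<close>

theorem theorem5:
  fixes \<E> :: "('n::finite \<times> 'n) set"
    and W :: "real^'n^'n" and \<pi> :: "real^'n"
    and f :: "'n \<Rightarrow> real^'m \<Rightarrow> real" and X :: "'n \<Rightarrow> (real^'m) set"
    and R L C \<eta> lam :: real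
    and \<alpha> :: "nat \<Rightarrow> real"
    and x g :: "nat \<Rightarrow> 'n \<Rightarrow> real^'m"
    and xopt :: "real^'m"
  defines "n \<equiv> real CARD('n)"
  defines "XX \<equiv> (\<Inter>i. X i)"
  defines "U \<equiv> convex hull (\<Union>i. X i)"
  defines "F \<equiv> (\<lambda>y. \<Sum>i\<in>UNIV. f i y)"
  defines "Fopt \<equiv> (INF y\<in>XX. F y)"
  defines "Xopt \<equiv> {y. is_arg_min F (\<lambda>y. y \<in> XX) y}"
  defines "\<pi>min \<equiv> Min (range (\<lambda>i. \<pi> $ i))"
  defines "D1 \<equiv> n * C * L * \<eta>"
  defines "D2 \<equiv> 2 * L * \<eta>"
  defines "D3 \<equiv> L\<^sup>2 * \<eta>\<^sup>2 + n * L * C * \<eta>"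
  defines "D4 \<equiv> C * (\<Sum>j\<in>UNIV. norm (x 0 j))"
  defines "D2' \<equiv> D2 + 2 * L * R / \<pi>min"
  defines "b \<equiv> sqrt (\<pi>min / n)"
  defines "a \<equiv> D2' * C / ((1 - lam) * b)"
  defines "D6 \<equiv> \<pi>min / 2"
  defines "D24 \<equiv> D2' * D4"
  defines "D21 \<equiv> D2' * D1"
  defines "D3' \<equiv> D3 + a\<^sup>2 / 2"
  defines "xbar \<equiv> (\<lambda>t. \<Sum>j\<in>UNIV. \<pi> $ j *\<^sub>R x t j)"
  defines "s \<equiv> (\<lambda>t. closest_point XX (xbar t))"
  defines "xtilde \<equiv> (\<lambda>i t. (\<Sum>k\<le>t. \<alpha> k *\<^sub>R x k i) /\<^sub>R (\<Sum>k\<le>t. \<alpha> k))"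
  defines "stilde \<equiv> (\<lambda>t. (\<Sum>k\<le>t. \<alpha> k *\<^sub>R s k) /\<^sub>R (\<Sum>k\<le>t. \<alpha> k))"
  defines "R2 \<equiv> 1/2 * prodinf (\<lambda>k. 1 + D1 * lam ^ (2 * k))"
  defines "R1 \<equiv> R2 * (\<Sum>i\<in>UNIV. \<pi> $ i * (norm (x 0 i - xopt))\<^sup>2)"
  defines "C0 \<equiv> D6 * (1 - lam) / (2 * n * (R * n + 1) * C)"
  defines "C1 \<equiv> R1 + R2 * D24 * \<alpha> 0 / (1 - lam) + D6 * D4 * \<alpha> 0 / (2 * n * C)"
  defines "C2 \<equiv> R2 * (D21 / (1 - lam) + D3') + D6 / (2 * n) * (D1 / C + 1/4)"
  defines "E \<equiv> (\<lambda>t. (C1 + C2 * (\<Sum>k\<le>t. (\<alpha> k)\<^sup>2)) / (\<Sum>k\<le>t. \<alpha> k))"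
  assumes strongly_connected: "\<And>i j. (i, j) \<in> \<E>\<^sup>*"
    and W_diag: "\<And>i. W $ i $ i > 0"
    and W_edge: "\<And>i j. (i, j) \<in> \<E> \<Longrightarrow> W $ i $ j > 0"
    and W_nonedge: "\<And>i j. i \<noteq> j \<Longrightarrow> (i, j) \<notin> \<E> \<Longrightarrow> W $ i $ j = 0"
    and W_row_stochastic: "W *v 1 = 1"
    and perron_pos: "\<And>i. \<pi> $ i > 0"
    and perron_left: "\<pi> v* W = \<pi>"
    and perron_sum: "(\<Sum>i\<in>UNIV. \<pi> $ i) = 1"
    and f_convex: "\<And>i. convex_on UNIV (f i)"
    and X_closed: "\<And>i. closed (X i)"
    and X_convex: "\<And>i. convex (X i)"
    and XX_nonempty: "XX \<noteq> {}"
    and R_ge_1: "R \<ge> 1"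
    and regularity: "\<And>y. y \<in> U \<Longrightarrow> infdist y XX \<le> R * Max (range (\<lambda>i. infdist y (X i)))"
    and L_pos: "L > 0"
    and bounded_subgradients: "\<And>i y h. y \<in> U \<Longrightarrow> h \<in> subdifferential (f i) y \<Longrightarrow> norm h \<le> L"
    and lam: "second_eigenvalue_modulus W < lam" "lam < 1"
    and C_pos: "C > 0"
    and eta_pos: "\<eta> > 0"
    and W_power_bound: "\<And>i j t. \<bar>matpow W t $ j $ i - \<pi> $ i\<bar> \<le> C * lam ^ t"
    and z_bound: "\<And>i t. \<bar>zseq W t i $ i - \<pi> $ i\<bar> \<le> C * lam ^ t"
    and z_range: "\<And>i t. inverse \<eta> \<le> zseq W t i $ i \<and> zseq W t i $ i \<le> 1"
    and step_nonneg: "\<And>t. \<alpha> t \<ge> 0"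
    and step_decseq: "decseq \<alpha>"
    and step_pos: "\<alpha> 0 > 0"
    and initial: "\<And>i. x 0 i \<in> X i"
    and generated: "algorithm1 W X f \<alpha> g x \<or> algorithm2 W X f \<alpha> g x"
    and xopt: "xopt \<in> Xopt"
  shows "\<forall>i t. C0 * norm (xtilde i t - stilde t) + F (stilde t) - Fopt \<le> E t
             \<and> \<bar>F (xtilde i t) - Fopt\<bar> \<le> E t * (1 + n * L / C0)"
proof -

  \<comment> \<open>Signs of the constants, optimal value and Lipschitz bounds\<close>
  have lam0: "0 \<le> lam"
    \<comment> \<open>The matrix power bound at time 1 gives \<open>0 \<le> C * lam\<close>.\<close>
    using order_trans[OF abs_ge_zero W_power_bound[of 1]] C_pos by (simp add: zero_le_mult_iff)
  have W_nonneg: "0 \<le> W $ i $ j" for i j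
    using W_diag[of i] W_edge[of i j] W_nonedge[of i j] by (cases "i = j"; cases "(i, j) \<in> \<E>") auto
  have W_row: "(\<Sum>j\<in>UNIV. W $ i $ j) = 1" for i
    using arg_cong[OF W_row_stochastic, of "\<lambda>v. v $ i"] by (simp add: matrix_vector_mult_def)
  have \<pi>W: "(\<Sum>i\<in>UNIV. \<pi> $ i * W $ i $ j) = \<pi> $ j" for j
    using arg_cong[OF perron_left, of "\<lambda>v. v $ j"] by (simp add: vector_matrix_mult_def mult.commute)
  have \<pi>0: "0 \<le> \<pi> $ i" for i using perron_pos[of i] by simp
  have n1: "1 \<le> n" by (simp add: n_def Suc_le_eq card_gt_0_iff)
  have \<pi>min_le: "\<pi>min \<le> \<pi> $ i" for i by (simp add: \<pi>min_def)
  have "\<pi>min \<in> range (\<lambda>i. \<pi> $ i)" unfolding \<pi>min_def by (intro Min_in) auto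
  then have \<pi>min_pos: "0 < \<pi>min" using perron_pos by auto
  \<comment> \<open>The resulting \<open>n \<le> 1 / \<pi>min\<close> is how
    \<open>1 / \<pi>min\<close>, rather than \<open>n\<close>, comes into
    \<open>D2'\<close>.\<close>
  have "(\<Sum>i::'n\<in>UNIV. \<pi>min) \<le> (\<Sum>i\<in>UNIV. \<pi> $ i)" by (intro sum_mono \<pi>min_le)
  then have "n * \<pi>min \<le> 1" by (simp add: perron_sum n_def)
  then have n_le: "n \<le> 1 / \<pi>min" using \<pi>min_pos by (simp add: pos_le_divide_eq)
  have D1: "0 \<le> D1" using n1 C_pos L_pos eta_pos by (simp add: D1_def)
  have D2': "0 \<le> D2'" using L_pos eta_pos \<pi>min_pos R_ge_1 by (simp add: D2'_def D2_def)
  have D3: "0 \<le> D3" using n1 C_pos L_pos eta_pos by (simp add: D3_def)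
  have D4: "0 \<le> D4" using C_pos by (simp add: D4_def sum_nonneg)
  have b: "0 < b" "b\<^sup>2 = \<pi>min / n" using n1 \<pi>min_pos by (auto simp: b_def)
  have XX: "closed XX" "convex XX" using X_closed X_convex by (auto simp: XX_def intro: convex_INT)
  have xopt_XX: "xopt \<in> XX" and xopt_min: "\<And>y. y \<in> XX \<Longrightarrow> F xopt \<le> F y"
    using xopt by (auto simp: Xopt_def is_arg_min_linorder)
  have Fopt: "Fopt = F xopt"
    unfolding Fopt_def using xopt XX_nonempty xopt_min
    by (intro cInf_eq_minimum) (auto simp: Xopt_def is_arg_min_linorder)
  have XU: "X i \<subseteq> U" for i unfolding U_def by (rule order_trans[OF _ hull_subset]) blast
  have XXU: "XX \<subseteq> U" using XU by (auto simp: XX_def)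
  have lip: "\<bar>f i u - f i v\<bar> \<le> L * norm (u - v)" if "u \<in> U" "v \<in> U" for i u v
    by (rule bounded_subgradients_Lipschitz[OF f_convex bounded_subgradients that])
  have F_lip: "\<bar>F u - F v\<bar> \<le> n * L * norm (u - v)" if "u \<in> U" "v \<in> U" for u v
  proof -
    have "\<bar>F u - F v\<bar> \<le> (\<Sum>i\<in>UNIV. \<bar>f i u - f i v\<bar>)"
      unfolding F_def sum_subtractf[symmetric] by (rule sum_abs)
    also have "\<dots> \<le> (\<Sum>i::'n\<in>UNIV. L * norm (u - v))" using lip[OF that] by (intro sum_mono)
    finally show ?thesis by (simp add: n_def)
  qed

  \<comment> \<open>Reduction to the common scheme and the quantities of the Lyapunov
    argument\<close>
  have subgradients_le: "\<forall>i. \<forall>y\<in>U. \<forall>h\<in>subdifferential (f i) y. norm h \<le> L"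
    using bounded_subgradients by blast
  obtain p and \<phi> :: "nat \<Rightarrow> 'n \<Rightarrow> real^'m" where x_in: "\<And>t i. x t i \<in> X i"
    and p_hull: "\<And>t i. p t i \<in> convex hull (range (x t))"
    and g: "\<And>t i. g t i \<in> subdifferential (f i) (p t i)"
    and pert: "\<And>t i. norm (x (Suc t) i - (\<Sum>j\<in>UNIV. W $ i $ j *\<^sub>R x t j)) \<le> norm (\<phi> t i) + \<alpha> t * L * \<eta>"
    and descent: "\<And>t y. y \<in> XX \<Longrightarrow> (\<Sum>i\<in>UNIV. \<pi> $ i * (norm (x (Suc t) i - y))\<^sup>2)
      \<le> (\<Sum>i\<in>UNIV. \<pi> $ i * (norm (x t i - y))\<^sup>2)
        - 2 * \<alpha> t * (\<Sum>i\<in>UNIV. \<pi> $ i / zseq W t i $ i * (g t i \<bullet> (p t i - y)))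
        + (\<alpha> t * L * \<eta>)\<^sup>2 - (\<Sum>i\<in>UNIV. \<pi> $ i * (norm (\<phi> t i))\<^sup>2)"
    using algorithms_descent[where W = W and \<pi> = \<pi> and X = X and x = x and L = L and \<eta> = \<eta>
          and \<alpha> = \<alpha> and f = f and g = g, folded XX_def U_def,
        OF W_nonneg W_row \<pi>0 perron_sum \<pi>W X_closed X_convex XX_nonempty initial
          subgradients_le eta_pos z_range[THEN conjunct1] step_nonneg generated]
    by blast
  define V where "V t = (\<Sum>i\<in>UNIV. \<pi> $ i * (norm (x t i - xopt))\<^sup>2)" for t
  define \<Phi> where "\<Phi> t = (\<Sum>i\<in>UNIV. norm (\<phi> t i))" for t
  define S where "S t = (\<Sum>i\<in>UNIV. \<pi> $ i * (norm (\<phi> t i))\<^sup>2)" for t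
  define G where "G t = F (s t) - F xopt" for t
  define \<Delta> where "\<Delta> t = D4 * lam ^ t + D1 * discounted_sum lam \<alpha> t + C * discounted_sum lam \<Phi> t" for t

  \<comment> \<open>Distances to the mean and to the feasible set\<close>
  have x_\<Delta>: "norm (x t i - xbar t) \<le> \<Delta> t" for t i
  proof -
    define e where "e t i = x (Suc t) i - (\<Sum>j\<in>UNIV. W $ i $ j *\<^sub>R x t j)" for t i
    have "norm (x t i - xbar t)
        \<le> D4 * lam ^ t + C * discounted_sum lam (\<lambda>k. \<Sum>j\<in>UNIV. norm (e k j)) t"
      unfolding xbar_def D4_def
      by (rule perturbed_averaging_consensus[where W = W]) (simp_all add: e_def \<pi>W W_power_bound)
    \<comment> \<open>The steps of all agents together contribute
      \<open>n * L * \<eta> * \<alpha> k\<close>, which the factor \<open>C\<close> turns into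
      \<open>D1 * \<alpha> k\<close>.\<close>
    also have "discounted_sum lam (\<lambda>k. \<Sum>j\<in>UNIV. norm (e k j)) t
        \<le> discounted_sum lam (\<lambda>k. 1 * \<Phi> k + (n * L * \<eta>) * \<alpha> k) t"
    proof (intro discounted_sum_mono lam0)
      fix k
      have "(\<Sum>j\<in>UNIV. norm (e k j)) \<le> (\<Sum>j\<in>UNIV. norm (\<phi> k j) + \<alpha> k * L * \<eta>)"
        unfolding e_def by (intro sum_mono pert)
      then show "(\<Sum>j\<in>UNIV. norm (e k j)) \<le> 1 * \<Phi> k + (n * L * \<eta>) * \<alpha> k"
        by (simp add: \<Phi>_def sum.distrib n_def mult_ac)
    qed
    finally show ?thesis
      using C_pos unfolding discounted_sum_linear by (simp add: \<Delta>_def D1_def distrib_left mult_ac)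
  qed
  \<comment> \<open>Balls are convex, so the bound passes from the iterates to the points
    \<open>p t i\<close> where subgradients are evaluated.\<close>
  have hull_\<Delta>: "norm (y - xbar t) \<le> \<Delta> t" if "y \<in> convex hull (range (x t))" for y t
  proof -
    have "convex hull (range (x t)) \<subseteq> cball (xbar t) (\<Delta> t)"
      using x_\<Delta> by (intro hull_minimal) (auto simp: dist_norm norm_minus_commute)
    then show ?thesis using that by (auto simp: dist_norm norm_minus_commute)
  qed
  have \<Delta>0: "0 \<le> \<Delta> t" for t using order_trans[OF norm_ge_zero x_\<Delta>] .
  have hull_U: "convex hull (range (x t)) \<subseteq> U" for t
    unfolding U_def using x_in by (intro hull_mono) blast
  have "xbar t \<in> convex hull (range (x t))" for t
    unfolding xbar_def using \<pi>0 perron_sum by (intro convex_sum) (auto intro: hull_inc)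
  then have xbar_U: "xbar t \<in> U" for t using hull_U by blast
  have s_XX: "s t \<in> XX" for t
    unfolding s_def using XX XX_nonempty by (intro closest_point_in_set)
  \<comment> \<open>Every \<open>X i\<close> contains \<open>x t i\<close>, so the mean lies within
    \<open>\<Delta> t\<close> of each of them; regularity turns this into a bound on the distance to
    the intersection.\<close>
  have s_\<Delta>: "norm (xbar t - s t) \<le> R * \<Delta> t" for t
  proof -
    have "norm (xbar t - s t) = infdist (xbar t) XX"
      using dist_closest_point_eq_infdist[OF XX(1) XX_nonempty] by (simp add: s_def dist_norm)
    also have "\<dots> \<le> R * Max (range (\<lambda>i. infdist (xbar t) (X i)))"
      by (intro regularity xbar_U)
    also have "Max (range (\<lambda>i. infdist (xbar t) (X i))) \<le> \<Delta> t"
    proof -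
      have "infdist (xbar t) (X i) \<le> \<Delta> t" for i
        using infdist_le2[OF x_in[of t i], of "xbar t" "\<Delta> t"] x_\<Delta>[of t i]
        by (simp add: dist_norm norm_minus_commute)
      then show ?thesis by simp
    qed
    finally show ?thesis using R_ge_1 by simp
  qed
  have G0: "0 \<le> G t" for t using xopt_min[OF s_XX] by (simp add: G_def)
  \<comment> \<open>Cauchy-Schwarz over the agents costs a factor \<open>n\<close>, and the weights
    are at least \<open>\<pi>min\<close>; this explains the choice of \<open>b\<close>.\<close>
  have S_\<Phi>: "b\<^sup>2 * (\<Phi> t)\<^sup>2 \<le> S t" for t
  proof -
    have "(\<Phi> t)\<^sup>2 \<le> (\<Sum>i\<in>UNIV. (norm (\<phi> t i))\<^sup>2) * n"
      unfolding \<Phi>_def n_def by (rule sum_squared_le_sum_of_squares)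
    then have "b\<^sup>2 * (\<Phi> t)\<^sup>2 \<le> \<pi>min / n * ((\<Sum>i\<in>UNIV. (norm (\<phi> t i))\<^sup>2) * n)"
      unfolding b(2) using n1 \<pi>min_pos by (intro mult_left_mono) auto
    also have "\<dots> = (\<Sum>i\<in>UNIV. \<pi>min * (norm (\<phi> t i))\<^sup>2)" using n1 by (simp add: sum_distrib_left)
    also have "\<dots> \<le> S t" unfolding S_def using \<pi>min_le by (intro sum_mono mult_right_mono) auto
    finally show ?thesis .
  qed

  \<comment> \<open>The Lyapunov recursion\<close>
  have V_Suc: "V (Suc t) \<le> (1 + D1 * lam ^ (2 * t)) * V t - 2 * \<alpha> t * G t
      + D2' * \<alpha> t * \<Delta> t + D3 * (\<alpha> t)\<^sup>2 - S t" for t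
  proof -
    define r where "r = norm (xbar t - xopt)"
    have "r\<^sup>2 = (norm (\<Sum>i\<in>UNIV. \<pi> $ i *\<^sub>R (x t i - xopt)))\<^sup>2"
      by (simp add: r_def xbar_def scaleR_right_diff_distrib sum_subtractf perron_sum
          flip: scaleR_sum_left)
    also have "\<dots> \<le> V t" unfolding V_def by (intro norm_sq_convex_combination \<pi>0 perron_sum)
    finally have r: "r\<^sup>2 \<le> V t" .
    \<comment> \<open>The error of \<open>zseq\<close> contributes a term linear in
      \<open>r\<close>. Young's inequality gives one part to \<open>(\<alpha> t)\<^sup>2\<close>,
      hence the summand \<open>n * L * C * \<eta>\<close> of \<open>D3\<close>, and the other to
      \<open>V t\<close>, hence the growth factor with \<open>lam ^ (2 * t)\<close>.\<close>
    have "2 * \<alpha> t * (lam ^ t * r) \<le> (\<alpha> t)\<^sup>2 + (lam ^ t * r)\<^sup>2"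
      using sum_squares_bound[of "\<alpha> t" "lam ^ t * r"] by simp
    also have "(lam ^ t * r)\<^sup>2 = lam ^ (2 * t) * r\<^sup>2"
      by (simp add: power_mult_distrib power_mult mult.commute[of 2] flip: power_mult)
    also have "\<dots> \<le> lam ^ (2 * t) * V t" using r lam0 by (intro mult_left_mono) auto
    finally have young: "D1 * (2 * \<alpha> t * (lam ^ t * r)) \<le> D1 * ((\<alpha> t)\<^sup>2 + lam ^ (2 * t) * V t)"
      using D1 by (intro mult_left_mono) auto
    have "n * L * norm (xbar t - s t) \<le> n * L * (R * \<Delta> t)"
      using s_\<Delta> n1 L_pos by (intro mult_left_mono) auto
    also have "\<dots> = n * (L * R * \<Delta> t)" by simp
    also have "\<dots> \<le> 1 / \<pi>min * (L * R * \<Delta> t)"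
      using n_le L_pos R_ge_1 \<Delta>0 by (intro mult_right_mono) auto
    finally have reg: "2 * \<alpha> t * (n * L * norm (xbar t - s t)) \<le> 2 * \<alpha> t * (L * R * \<Delta> t / \<pi>min)"
      using step_nonneg by (intro mult_left_mono) auto
    have "- (\<Sum>i\<in>UNIV. \<pi> $ i / zseq W t i $ i * (g t i \<bullet> (p t i - xopt)))
      \<le> L * \<eta> * \<Delta> t + n * (\<eta> * (C * lam ^ t) * L * r + L * norm (xbar t - s t)) - G t"
      unfolding r_def n_def G_def F_def
    proof (rule weighted_subgradient_inner_le)
      show "p t i \<in> U" for i using p_hull hull_U by blast
      show "norm (p t i - xbar t) \<le> \<Delta> t" for i by (intro hull_\<Delta> p_hull)
    qed (use g lip xbar_U s_XX xopt_XX XXU L_pos eta_pos \<pi>0 perron_sum z_range z_bound in auto)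
    then have "2 * \<alpha> t * - (\<Sum>i\<in>UNIV. \<pi> $ i / zseq W t i $ i * (g t i \<bullet> (p t i - xopt)))
      \<le> 2 * \<alpha> t * (L * \<eta> * \<Delta> t + n * (\<eta> * (C * lam ^ t) * L * r + L * norm (xbar t - s t)) - G t)"
      using step_nonneg by (intro mult_left_mono) auto
    also have "\<dots> = D2 * \<alpha> t * \<Delta> t + D1 * (2 * \<alpha> t * (lam ^ t * r))
        + 2 * \<alpha> t * (n * L * norm (xbar t - s t)) - 2 * \<alpha> t * G t"
      by (simp add: D1_def D2_def algebra_simps)
    also have "\<dots> \<le> D2 * \<alpha> t * \<Delta> t + D1 * ((\<alpha> t)\<^sup>2 + lam ^ (2 * t) * V t)
        + 2 * \<alpha> t * (L * R * \<Delta> t / \<pi>min) - 2 * \<alpha> t * G t"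
      using young reg by linarith
    also have "\<dots> = D2' * \<alpha> t * \<Delta> t + D1 * (\<alpha> t)\<^sup>2 + D1 * lam ^ (2 * t) * V t - 2 * \<alpha> t * G t"
      by (simp add: D2'_def distrib_left distrib_right)
    finally have "V (Suc t) \<le> V t + (D2' * \<alpha> t * \<Delta> t + D1 * (\<alpha> t)\<^sup>2 + D1 * lam ^ (2 * t) * V t
        - 2 * \<alpha> t * G t) + (\<alpha> t * L * \<eta>)\<^sup>2 - S t"
      using descent[OF xopt_XX, of t] unfolding V_def S_def by linarith
    moreover have "D3 * (\<alpha> t)\<^sup>2 = (\<alpha> t * L * \<eta>)\<^sup>2 + D1 * (\<alpha> t)\<^sup>2"
      by (simp add: D3_def D1_def power_mult_distrib algebra_simps)
    ultimately show ?thesis by (simp add: distrib_right)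
  qed

  \<comment> \<open>Summation over time\<close>
  have nonneg: "0 \<le> V t" "0 \<le> S t" "0 \<le> \<Phi> t" for t
    using \<pi>0 by (auto simp: V_def S_def \<Phi>_def intro!: sum_nonneg)
  have main: "C0 * (\<Sum>k\<le>t. \<alpha> k * norm (x k i - s k)) + (\<Sum>k\<le>t. \<alpha> k * G k)
      \<le> C1 + C2 * (\<Sum>k\<le>t. (\<alpha> k)\<^sup>2)" for i t
  proof -
    define A2 where "A2 = (\<Sum>k\<le>t. (\<alpha> k)\<^sup>2)"
    \<comment> \<open>With this choice \<open>K * C = b\<^sup>2 / 4\<close>, so the terms
      \<open>K * C * (\<Phi> k)\<^sup>2\<close> are covered by \<open>S k / 4\<close>, the residual
      decrease that remains after halving the Lyapunov sum.\<close>
    define K where "K = D6 / (2 * n * C)"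
    have K: "0 \<le> K" using \<pi>min_pos n1 C_pos by (simp add: K_def D6_def)
    define B where "B = R1 + R2 * D24 * \<alpha> 0 / (1 - lam) + R2 * (D21 / (1 - lam) + D3') * A2"
    define H where "H = D4 * \<alpha> 0 + D1 * A2 + C * (A2 / 4)"
    \<comment> \<open>Halving this estimate is the origin of the factor 1/2 in
      \<open>R2\<close>.\<close>
    have "2 * ((\<Sum>k\<le>t. \<alpha> k * G k) + (\<Sum>k\<le>t. S k / 4)) = (\<Sum>k\<le>t. 2 * \<alpha> k * G k + S k / 2)"
      unfolding sum.distrib[symmetric] sum_distrib_left by (intro sum.cong) auto
    also have "\<dots> \<le> 2 * R2 * (V 0 + D24 * \<alpha> 0 / (1 - lam) + (D21 / (1 - lam) + D3') * A2)"
      using sum_Lyapunov_descent_le[OF lam0 lam(2) nonneg(1) G0 nonneg(3,2) step_nonneg step_decseq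
          D1 D2' D3 D4 less_imp_le[OF C_pos] b(1) a_def[THEN meta_eq_to_obj_eq] \<Delta>_def S_\<Phi> V_Suc, of "Suc t"]
      by (simp only: lessThan_Suc_atMost R2_def A2_def D24_def D21_def D3'_def)
    also have "\<dots> = 2 * B"
      by (simp add: B_def R1_def V_def algebra_simps)
    finally have "(\<Sum>k\<le>t. \<alpha> k * G k) + (\<Sum>k\<le>t. S k / 4) \<le> B" by simp
    moreover have "(\<Sum>k\<le>t. K * C * (\<Phi> k)\<^sup>2) \<le> (\<Sum>k\<le>t. S k / 4)"
      using S_\<Phi> C_pos by (intro sum_mono) (simp add: b K_def D6_def)
    moreover have "C0 * (\<Sum>k\<le>t. \<alpha> k * norm (x k i - s k))
        \<le> K * H + (\<Sum>k\<le>t. K * C * (\<Phi> k)\<^sup>2)"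
    proof -
      define M where "M = R * n + 1"
      have "0 \<le> R * n" using R_ge_1 n1 by (intro mult_nonneg_nonneg) auto
      then have M: "0 < M" by (simp add: M_def)
      \<comment> \<open>\<open>M\<close> bounds the ratio of \<open>norm (x k i - s k)\<close> to
        \<open>\<Delta> k\<close>; the factor \<open>1 - lam\<close> is spent on the geometric sums
        below.\<close>
      have C0: "C0 = K * (1 - lam) / M"
        unfolding C0_def K_def M_def[symmetric] by (simp add: mult_ac)
      have "C0 * norm (x k i - s k) \<le> K * (1 - lam) * \<Delta> k" for k
      proof -
        have "norm (x k i - s k) \<le> norm (x k i - xbar k) + norm (xbar k - s k)"
          using norm_triangle_ineq[of "x k i - xbar k" "xbar k - s k"] by simp
        also have "\<dots> \<le> (R + 1) * \<Delta> k" using x_\<Delta>[of k i] s_\<Delta>[of k] by (simp add: distrib_right)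
        also have "\<dots> \<le> M * \<Delta> k"
          unfolding M_def using R_ge_1 n1 \<Delta>0 by (intro mult_right_mono) auto
        finally have "C0 * norm (x k i - s k) \<le> C0 * (M * \<Delta> k)"
          using C0 K lam M by (intro mult_left_mono) auto
        then show ?thesis using M by (simp add: C0)
      qed
      then have "(\<Sum>k\<le>t. \<alpha> k * (C0 * norm (x k i - s k))) \<le> (\<Sum>k\<le>t. \<alpha> k * (K * (1 - lam) * \<Delta> k))"
        using step_nonneg by (intro sum_mono mult_left_mono)
      also have "\<dots> = K * (D4 * ((1 - lam) * (\<Sum>k\<le>t. \<alpha> k * lam ^ k))
          + D1 * ((1 - lam) * (\<Sum>k\<le>t. \<alpha> k * discounted_sum lam \<alpha> k))
          + C * ((1 - lam) * (\<Sum>k\<le>t. \<alpha> k * discounted_sum lam \<Phi> k)))"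
        unfolding \<Delta>_def sum_distrib_left sum.distrib[symmetric]
        by (intro sum.cong) (auto simp: algebra_simps)
      also have "\<dots> \<le> K * (D4 * \<alpha> 0 + D1 * A2 + C * (A2 / 4 + (\<Sum>k\<le>t. (\<Phi> k)\<^sup>2)))"
      proof (intro mult_left_mono add_mono)
        show "(1 - lam) * (\<Sum>k\<le>t. \<alpha> k * lam ^ k) \<le> \<alpha> 0"
          using sum_decseq_geometric_le[OF lam0 lam(2) step_nonneg step_decseq, of "Suc t"] lam
          by (simp add: lessThan_Suc_atMost pos_le_divide_eq mult.commute)
        show "(1 - lam) * (\<Sum>k\<le>t. \<alpha> k * discounted_sum lam \<alpha> k) \<le> A2"
          using sum_decseq_discounted_sum_le[OF lam0 lam(2) step_nonneg step_decseq, of "Suc t"]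
          by (simp add: lessThan_Suc_atMost A2_def)
        \<comment> \<open>Splitting with \<open>\<alpha> t / 2\<close> leaves coefficient 1 on the
          squared residual, which matches \<open>K * C\<close>, and produces the summand 1/4 of
          \<open>C2\<close>.\<close>
        have "\<alpha> t * \<Phi> k \<le> (\<alpha> t)\<^sup>2 / 4 + (\<Phi> k)\<^sup>2" for t k
          using sum_squares_bound[of "\<alpha> t / 2" "\<Phi> k"] by (simp add: power_divide)
        then show "(1 - lam) * (\<Sum>k\<le>t. \<alpha> k * discounted_sum lam \<Phi> k) \<le> A2 / 4 + (\<Sum>k\<le>t. (\<Phi> k)\<^sup>2)"
          using sum_weighted_discounted_sum_le[OF lam0 lam(2),
              of "\<lambda>t. (\<alpha> t)\<^sup>2 / 4" "\<lambda>k. (\<Phi> k)\<^sup>2" \<alpha> \<Phi> "Suc t"]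
          by (simp add: lessThan_Suc_atMost A2_def sum_divide_distrib)
      qed (use K D1 D4 C_pos in auto)
      also have "\<dots> = K * H + (\<Sum>k\<le>t. K * C * (\<Phi> k)\<^sup>2)"
        by (simp add: H_def distrib_left sum_distrib_left mult_ac)
      finally show ?thesis by (simp add: sum_distrib_left mult_ac)
    qed
    moreover have "C1 + C2 * A2 = B + K * H"
      using C_pos n1 by (simp add: C1_def C2_def B_def H_def K_def field_simps)
    ultimately show ?thesis unfolding A2_def by linarith
  qed

  \<comment> \<open>Passage to the weighted averages\<close>
  show ?thesis
  proof (intro allI)
    fix i t
    define A where "A = (\<Sum>k\<le>t. \<alpha> k)"
    define w where "w k = \<alpha> k / A" for k
    \<comment> \<open>The first step size alone keeps the divisor positive, even if all later ones
      vanish.\<close>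
    have "\<alpha> 0 \<le> A" unfolding A_def using step_nonneg by (intro member_le_sum) auto
    then have A: "0 < A" using step_pos by simp
    have w: "\<And>k. 0 \<le> w k" "(\<Sum>k\<le>t. w k) = 1"
      using A step_nonneg by (auto simp: w_def A_def simp flip: sum_divide_distrib)
    have xt: "xtilde i t = (\<Sum>k\<le>t. w k *\<^sub>R x k i)" and st: "stilde t = (\<Sum>k\<le>t. w k *\<^sub>R s k)"
      by (simp_all add: xtilde_def stilde_def w_def A_def scaleR_sum_right divide_inverse_commute)
    \<comment> \<open>Convexity places the average of agent \<open>i\<close> in \<open>X i\<close>,
      while \<open>stilde t\<close> is feasible. Both lie in \<open>U\<close>, where
      \<open>F_lip\<close> applies.\<close>
    have xt_in: "xtilde i t \<in> U"
      unfolding xt using w x_in X_convex XU[of i] by (intro subsetD[OF XU[of i]] convex_sum) auto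
    have st_in: "stilde t \<in> XX"
      unfolding st using w s_XX XX by (intro convex_sum) auto
    have "norm (xtilde i t - stilde t) \<le> (\<Sum>k\<le>t. w k * norm (x k i - s k))"
      unfolding xt st sum_subtractf[symmetric] scaleR_right_diff_distrib[symmetric]
      using w by (intro sum_norm_le) simp
    also have "\<dots> = (\<Sum>k\<le>t. \<alpha> k * norm (x k i - s k)) / A"
      by (simp add: w_def sum_divide_distrib)
    finally have dist_le: "norm (xtilde i t - stilde t) \<le> \<dots>" .
    have "F (stilde t) \<le> (\<Sum>j\<in>UNIV. \<Sum>k\<le>t. w k * f j (s k))"
      unfolding F_def st using w by (intro sum_mono convex_on_sum[OF _ _ f_convex]) auto
    also have "\<dots> = (\<Sum>k\<le>t. w k * F (s k))"
      unfolding F_def sum_distrib_left by (rule sum.swap)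
    also have "\<dots> = (\<Sum>k\<le>t. w k * G k) + F xopt"
      using w(2) by (simp add: G_def right_diff_distrib sum_subtractf flip: sum_distrib_right)
    also have "(\<Sum>k\<le>t. w k * G k) = (\<Sum>k\<le>t. \<alpha> k * G k) / A"
      by (simp add: w_def sum_divide_distrib)
    finally have F_le: "F (stilde t) - Fopt \<le> (\<Sum>k\<le>t. \<alpha> k * G k) / A" by (simp add: Fopt)
    have C0: "0 < C0"
      using \<pi>min_pos lam n1 R_ge_1 C_pos by (auto simp: C0_def D6_def intro!: divide_pos_pos mult_pos_pos add_nonneg_pos)
    have "C0 * norm (xtilde i t - stilde t) + (F (stilde t) - Fopt)
      \<le> C0 * ((\<Sum>k\<le>t. \<alpha> k * norm (x k i - s k)) / A) + (\<Sum>k\<le>t. \<alpha> k * G k) / A"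
      using dist_le F_le C0 by (intro add_mono mult_left_mono) auto
    also have "\<dots> = (C0 * (\<Sum>k\<le>t. \<alpha> k * norm (x k i - s k)) + (\<Sum>k\<le>t. \<alpha> k * G k)) / A"
      by (simp add: add_divide_distrib)
    also have "\<dots> \<le> E t" unfolding E_def A_def[symmetric] using main A by (intro divide_right_mono) auto
    finally have first: "C0 * norm (xtilde i t - stilde t) + (F (stilde t) - Fopt) \<le> E t" .
    \<comment> \<open>Feasibility of \<open>stilde t\<close> makes its optimality gap nonnegative,
      so either term of the first bound may be dropped. This isolates the distance needed to
      transfer the gap to \<open>xtilde i t\<close>.\<close>
    have Fs: "0 \<le> F (stilde t) - Fopt" using xopt_min[OF st_in] by (simp add: Fopt)
    have "C0 * norm (xtilde i t - stilde t) \<le> E t" using first Fs by linarith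
    then have "norm (xtilde i t - stilde t) \<le> E t / C0" using C0 by (simp add: pos_le_divide_eq mult.commute)
    then have "n * L * norm (xtilde i t - stilde t) \<le> n * L * (E t / C0)"
      using n1 L_pos by (intro mult_left_mono) auto
    moreover have "\<bar>F (xtilde i t) - F (stilde t)\<bar> \<le> n * L * norm (xtilde i t - stilde t)"
      using xt_in st_in XXU by (intro F_lip) auto
    moreover have "0 \<le> C0 * norm (xtilde i t - stilde t)" using C0 by simp
    ultimately have "\<bar>F (xtilde i t) - Fopt\<bar> \<le> E t + n * L * (E t / C0)" using first Fs by linarith
    then show "C0 * norm (xtilde i t - stilde t) + F (stilde t) - Fopt \<le> E t
        \<and> \<bar>F (xtilde i t) - Fopt\<bar> \<le> E t * (1 + n * L / C0)"
      using first by (simp add: distrib_left mult_ac)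
  qed
qed

end
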